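(* Let $r\geq 1$, $n\geq 1$ and $m\geq 0$ be integers and let $Y_m:[0,1]\to F(\mathbf{R}^{r+1},m)$ be a continuous trajectory of $m$ obstacles. Then: (a) The map $\pi(Y_m):E(Y_m)\to B(Y_m)$ is a locally trivial fibration. (b) The fiberwise homeomorphism type of the fibration $\pi(Y_m)$ is independent of the trajectory of moving obstacles $Y_m$; that is, for any two continuous trajectories $Y_m,Y_m':[0,1]\to F(\mathbf{R}^{r+1},m)$ there are homeomorphisms $\tilde F:E(Y_m)\to E(Y_m')$ and $\tilde G:B(Y_m)\to B(Y_m')$ with $\pi(Y_m')\circ \tilde F=\tilde G\circ\pi(Y_m)$. In particular, the Schwarz genus of $\pi(Y_m)$ equals the Schwarz genus in the special case when the obstacles are stationary (i.e. the trajectory is constant). (c) The Schwarz genus of $\pi(Y_m)$ equals $\mathbf{TC}(F(\mathbf{R}^{r+1}-S_m,n))$, where $S_m=\{s_1,\dots,s_m\}\subset\mathbf{R}^{r+1}$ is an arbitrary fixed $m$-element subset.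
   Context: For a topological space $X$, $F(X,n)\subset X^n$ denotes the configuration space of $n$-tuples $(x_1,\dots,x_n)$ with $x_i\neq x_j$ for $i\neq j$ (subspace topology). Write $Y_m(t)=(C_1(t),\dots,C_m(t))$. For a configuration $A=(A_1,\dots,A_n)\in F(\mathbf{R}^{r+1},n)$, the notation $A\cap Y_m(t)=\emptyset$ means $A_i\neq C_j(t)$ for all $i=1,\dots,n$ and $j=1,\dots,m$. Define $$E(Y_m)=\{\gamma:[0,1]\to F(\mathbf{R}^{r+1},n)\text{ continuous};\ \gamma(t)\cap Y_m(t)=\emptyset\ \ \forall t\in[0,1]\}$$ with the compact-open topology, $$B(Y_m)=\{(A,B)\in F(\mathbf{R}^{r+1},n)\times F(\mathbf{R}^{r+1},n);\ A\cap Y_m(0)=\emptyset,\ B\cap Y_m(1)=\emptyset\},$$ and $\pi(Y_m):E(Y_m)\to B(Y_m)$, $\pi(Y_m)(\gamma)=(\gamma(0),\gamma(1))$. The Schwarz genus of a continuous map $f:X\to Y$ is the minimal integer $k$ such that $Y$ can be covered by $k$ open sets $U_1,\dots,U_k$ over each of which there is a continuous section $s_i:U_i\to X$, $f\circ s_i=1_{U_i}$. For a topological space $X$, $\mathbf{TC}(X)$ denotes the Schwarz genus of the path space fibration $\pi:X^I\to X\times X$, $\pi(\gamma)=(\gamma(0),\gamma(1))$, where $X^I$ is the space of all continuous paths $\gamma:I=[0,1]\to X$ with the compact-open topology. *)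

theory Defs
  imports "HOL-Analysis.Analysis"
begin

text \<open>The points of \<open>X\<^sup>n\<close> are the functions on \<open>{1..n}\<close> that are extensional, i.e. take the value
  \<^const>\<open>undefined\<close> outside \<open>{1..n}\<close>, as in the library's product topology.\<close>

definition config_space :: "'a topology \<Rightarrow> nat \<Rightarrow> (nat \<Rightarrow> 'a) topology" where
  "config_space X n = subtopology (product_topology (\<lambda>_. X) {1..n}) {x. inj_on x {1..n}}"

text \<open>Likewise a continuous map is represented by its extensional representative, so that
  the points of a mapping space correspond to the continuous maps one-to-one.\<close>

definition cont_maps :: "'a topology \<Rightarrow> 'b topology \<Rightarrow> ('a \<Rightarrow> 'b) set" where
  "cont_maps X Y = {f \<in> extensional (topspace X). continuous_map X Y f}"

definition compact_open :: "'a topology \<Rightarrow> 'b topology \<Rightarrow> ('a \<Rightarrow> 'b) topology" where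
  "compact_open X Y =
     topology_generated_by {{f \<in> cont_maps X Y. f ` K \<subseteq> U} |K U. compactin X K \<and> openin Y U}"

abbreviation unit_interval :: "real topology" where
  "unit_interval \<equiv> top_of_set {0..1}"

definition path_space :: "'a topology \<Rightarrow> (real \<Rightarrow> 'a) topology" where
  "path_space X = compact_open unit_interval X"

definition endpoints :: "(real \<Rightarrow> 'a) \<Rightarrow> 'a \<times> 'a" where
  "endpoints \<gamma> = (\<gamma> 0, \<gamma> 1)"

text \<open>The minimal number of open sets may fail to exist; the genus is then \<open>\<infinity>\<close>, the infimum
  of the empty set. A nonempty infimum of extended naturals is attained.\<close>

definition schwarz_genus :: "'e topology \<Rightarrow> 'b topology \<Rightarrow> ('e \<Rightarrow> 'b) \<Rightarrow> enat" where
  "schwarz_genus X Y f =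
     Inf {enat k |k. \<exists>U. (\<Union>i\<in>{1..k}. U i) = topspace Y \<and>
        (\<forall>i\<in>{1..k}. openin Y (U i) \<and>
           (\<exists>s. continuous_map (subtopology Y (U i)) X s \<and> (\<forall>y\<in>U i. f (s y) = y)))}"

definition TC :: "'a topology \<Rightarrow> enat" where
  "TC X = schwarz_genus (path_space X) (prod_topology X X) endpoints"

text \<open>Local triviality with a single typical fibre \<open>F\<close>. Taking \<open>F\<close> on the type of the total
  space is no restriction, since \<open>F\<close> is homeomorphic to a fibre as soon as the base is nonempty.\<close>

definition locally_trivial_fibration :: "'e topology \<Rightarrow> 'b topology \<Rightarrow> ('e \<Rightarrow> 'b) \<Rightarrow> bool" where
  "locally_trivial_fibration E B p \<longleftrightarrow>
     continuous_map E B p \<and>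
     (\<exists>F :: 'e topology. \<forall>b\<in>topspace B. \<exists>U h.
        openin B U \<and> b \<in> U \<and>
        homeomorphic_map (prod_topology (subtopology B U) F)
                         (subtopology E {x \<in> topspace E. p x \<in> U}) h \<and>
        (\<forall>u\<in>U. \<forall>v\<in>topspace F. p (h (u, v)) = u))"

text \<open>\<open>config_avoids n m A c\<close> is \<open>A \<inter> {c\<^sub>1, \<dots>, c\<^sub>m} = \<emptyset>\<close>.\<close>

definition config_avoids :: "nat \<Rightarrow> nat \<Rightarrow> (nat \<Rightarrow> 'a) \<Rightarrow> (nat \<Rightarrow> 'a) \<Rightarrow> bool" where
  "config_avoids n m A c \<longleftrightarrow> (\<forall>i\<in>{1..n}. \<forall>j\<in>{1..m}. A i \<noteq> c j)"

text \<open>The values of an obstacle trajectory \<open>Y\<close> outside \<open>{0..1}\<close> are irrelevant below.\<close>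

definition obstacle_trajectory ::
    "nat \<Rightarrow> (real \<Rightarrow> nat \<Rightarrow> 'a::topological_space) \<Rightarrow> bool" where
  "obstacle_trajectory m Y \<longleftrightarrow> continuous_map unit_interval (config_space euclidean m) Y"

definition E_space ::
    "nat \<Rightarrow> nat \<Rightarrow> (real \<Rightarrow> nat \<Rightarrow> 'a::topological_space) \<Rightarrow> (real \<Rightarrow> nat \<Rightarrow> 'a) topology" where
  "E_space n m Y =
     subtopology (path_space (config_space euclidean n))
       {\<gamma>. \<forall>t\<in>{0..1}. config_avoids n m (\<gamma> t) (Y t)}"

definition B_space ::
    "nat \<Rightarrow> nat \<Rightarrow> (real \<Rightarrow> nat \<Rightarrow> 'a::topological_space) \<Rightarrow> ((nat \<Rightarrow> 'a) \<times> (nat \<Rightarrow> 'a)) topology" where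
  "B_space n m Y =
     subtopology (prod_topology (config_space euclidean n) (config_space euclidean n))
       {(A, B). config_avoids n m A (Y 0) \<and> config_avoids n m B (Y 1)}"

end

(* Bump functions give homeomorphisms of R^d, depending continuously on a parameter, that push
   finitely many points to prescribed nearby positions and fix all far points. Splicing them along
   the compact interval yields an ambient isotopy that makes any obstacle trajectory stationary, at
   any chosen positions; letting it act pointwise in time identifies E(Y) over B(Y) with the
   stationary case, where E is the path space of X = F(R^d - S, n) and B is X x X. For the path
   fibration the same bump pushes, fixing S, carry the fibre over (A, B) to the nearby fibres; since
   d >= 2 the base is connected, so that all fibres are homeomorphic. *)

theory Submission
  imports Defs
begin

section \<open>Mapping spaces and configuration spaces\<close>

text \<open>An ambient isotopy acts on path spaces together with its inverse, so the inverse must be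
  continuous in the point and the parameter jointly. This dictates the form of the pushes: each is
  the identity plus a map with Lipschitz constant at most 1/2. Banach's fixed point theorem then
  yields the inverse and an expansion estimate yields its joint continuity, without flows or
  smoothness. A bump of radius \<rho> has Lipschitz constant 1/\<rho>, whence the recurring bound
  \<rho>/2 on the total displacement; it confines every push to short times or small neighbourhoods.
  Both ends of a path are treated by one isotopy, in which the push at the initial configuration has
  weight 1 - t and the push at the final one has weight t. Dimension at least 2 enters a second time
  besides the connectedness of the base: straightening leaves the obstacles at positions dictated by
  the trajectory, and carrying these to prescribed positions may change their order, which no
  homeomorphism of the line can do freely.\<close>

lemma topspace_compact_open [simp]: "topspace (compact_open X Y) = cont_maps X Y"
proof
  show "topspace (compact_open X Y) \<subseteq> cont_maps X Y"
    unfolding compact_open_def topology_generated_by_topspace by blast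
  \<comment> \<open>The whole mapping space is itself a subbasic set, the one for empty
    \<open>K\<close> and empty \<open>U\<close>.\<close>
  have "cont_maps X Y = {f \<in> cont_maps X Y. f ` {} \<subseteq> {}}"
    by simp
  then show "cont_maps X Y \<subseteq> topspace (compact_open X Y)"
    unfolding compact_open_def topology_generated_by_topspace
    using compactin_empty openin_empty by blast
qed

text \<open>The currying half of the exponential law. If \<open>g s\<close> maps the compact
  \<open>K\<close> into \<open>U\<close>, the slice over \<open>s\<close> lies in an open preimage,
  and the tube lemma thickens it to a product over a neighbourhood of \<open>s\<close>. The
  restriction selects the extensional representative, the only one that is a point of the mapping
  space.\<close>

lemma continuous_map_into_compact_open:
  assumes g: "continuous_map (prod_topology T X) Y (\<lambda>(s, x). g s x)"
  shows "continuous_map T (compact_open X Y) (\<lambda>s. restrict (g s) (topspace X))"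
proof -
  have cont: "restrict (g s) (topspace X) \<in> cont_maps X Y" if "s \<in> topspace T" for s
  proof -
    have "continuous_map X Y (\<lambda>x. case (s, x) of (s, x) \<Rightarrow> g s x)"
      using that by (intro continuous_map_compose[OF _ g, unfolded o_def] continuous_intros) simp
    then show ?thesis
      unfolding cont_maps_def by (auto intro: continuous_map_eq)
  qed
  have "openin T ((\<lambda>s. restrict (g s) (topspace X)) -` {f \<in> cont_maps X Y. f ` K \<subseteq> U} \<inter> topspace T)"
    (is "openin T ?V") if K: "compactin X K" and U: "openin Y U" for K U
  proof -
    let ?W = "{z \<in> topspace (prod_topology T X). (case z of (s, x) \<Rightarrow> g s x) \<in> U}"
    have "openin (prod_topology T X) ?W"
      using g U by (rule openin_continuous_map_preimage)
    moreover have "K \<subseteq> topspace X"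
      using K compactin_subset_topspace by blast
    ultimately have "\<exists>N. openin T N \<and> s \<in> N \<and> N \<subseteq> ?V" if "s \<in> ?V" for s
    proof -
      have "s \<in> topspace T" "{s} \<times> K \<subseteq> ?W"
        using that \<open>K \<subseteq> topspace X\<close> by auto
      then have "\<exists>N M. openin T N \<and> openin X M \<and> s \<in> N \<and> K \<subseteq> M \<and> N \<times> M \<subseteq> ?W"
        using \<open>openin _ ?W\<close> K by (intro tube_lemma_right)
      then obtain N M where N: "openin T N" "s \<in> N" "K \<subseteq> M" "N \<times> M \<subseteq> ?W"
        by (elim exE conjE)
      have "N \<subseteq> ?V"
      proof
        fix a assume "a \<in> N"
        then have "{a} \<times> K \<subseteq> ?W" "a \<in> topspace T"
          using N openin_subset by blast+
        then show "a \<in> ?V"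
          using cont \<open>K \<subseteq> topspace X\<close> by auto
      qed
      with N(1,2) show ?thesis
        by blast
    qed
    then show ?thesis
      by (subst openin_subopen) blast
  qed
  then show ?thesis
    unfolding compact_open_def using cont
    by (intro continuous_on_generated_topo)
      (auto simp flip: topology_generated_by_topspace compact_open_def)
qed

text \<open>The evaluation half of the exponential law. Near \<open>(f, x)\<close>, a compact
  neighbourhood \<open>K\<close> of \<open>x\<close> with f(K) inside \<open>U\<close> supplies a
  subbasic neighbourhood of \<open>f\<close> all of whose members send the interior part
  \<open>V\<close> of \<open>K\<close> into \<open>U\<close>. With the preceding lemma, later
  continuity proofs reduce to maps of a path and a time.\<close>

lemma continuous_map_compact_open_apply:
  assumes X: "locally_compact_space X" "Hausdorff_space X \<or> regular_space X"
  shows "continuous_map (prod_topology (compact_open X Y) X) Y (\<lambda>(f, x). f x)"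
  unfolding continuous_map_def
proof (intro conjI allI impI)
  show "(\<lambda>(f, x). f x) \<in> topspace (prod_topology (compact_open X Y) X) \<rightarrow> topspace Y"
    by (auto simp: cont_maps_def continuous_map_def)
next
  fix U assume U: "openin Y U"
  let ?W = "{z \<in> topspace (prod_topology (compact_open X Y) X). (case z of (f, x) \<Rightarrow> f x) \<in> U}"
  have "\<exists>N. openin (prod_topology (compact_open X Y) X) N \<and> (f, x) \<in> N \<and> N \<subseteq> ?W"
    if fx: "(f, x) \<in> ?W" for f x
  proof -
    have f: "f \<in> cont_maps X Y" "continuous_map X Y f" and x: "x \<in> topspace X" "f x \<in> U"
      using fx by (auto simp: cont_maps_def)
    have "openin X {y \<in> topspace X. f y \<in> U}"
      using f(2) U by (rule openin_continuous_map_preimage)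
    moreover have "neighbourhood_base_of (compactin X) X"
      using X locally_compact_space_neighbourhood_base by blast
    ultimately obtain V K where V: "openin X V" "compactin X K" "x \<in> V" "V \<subseteq> K" "K \<subseteq> {y \<in> topspace X. f y \<in> U}"
      unfolding neighbourhood_base_of using x
      by (elim allE[of _ "{y \<in> topspace X. f y \<in> U}"] allE[of _ x]) blast
    let ?S = "{h \<in> cont_maps X Y. h ` K \<subseteq> U}"
    have "openin (compact_open X Y) ?S"
      unfolding compact_open_def using V U by (intro topology_generated_by_Basis) blast
    then have "openin (prod_topology (compact_open X Y) X) (?S \<times> V)"
      using V by (simp add: openin_prod_Times_iff)
    moreover have "(f, x) \<in> ?S \<times> V"
      using V f by auto
    moreover have "?S \<times> V \<subseteq> ?W"
      using V by auto
    ultimately show ?thesis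
      by blast
  qed
  then show "openin (prod_topology (compact_open X Y) X) ?W"
    by (subst openin_subopen) (metis (no_types, lifting) surj_pair)
qed

text \<open>The two spaces have the same points, and currying the two evaluation maps shows that the
  identity is continuous in both directions. This is what later turns paths avoiding stationary
  obstacles into the path space of a subspace, with the right topology.\<close>

lemma compact_open_subtopology:
  assumes X: "locally_compact_space X" "Hausdorff_space X \<or> regular_space X"
  shows "compact_open X (subtopology Y S) = subtopology (compact_open X Y) {f. \<forall>x\<in>topspace X. f x \<in> S}"
    (is "?L = ?R")
proof -
  have top: "topspace ?L = topspace ?R"
    by (auto simp: cont_maps_def continuous_map_in_subtopology)
  have ext: "restrict f (topspace X) = f" if "f \<in> topspace ?R" for f
    using that by (auto simp: cont_maps_def extensional_restrict)
  have "continuous_map (prod_topology ?L X) Y (\<lambda>(f, x). f x)"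
    using continuous_map_compact_open_apply[OF X] continuous_map_in_subtopology by blast
  then have "continuous_map ?L (compact_open X Y) (\<lambda>f. restrict f (topspace X))"
    by (rule continuous_map_into_compact_open)
  then have "continuous_map ?L (compact_open X Y) id"
    by (rule continuous_map_eq) (use ext top in auto)
  then have 1: "continuous_map ?L ?R id"
    using top by (auto simp: continuous_map_in_subtopology)
  have "continuous_map (prod_topology ?R X) (subtopology Y S) (\<lambda>(f, x). f x)"
    using continuous_map_compact_open_apply[OF X, of Y]
    by (auto simp: continuous_map_in_subtopology prod_topology_subtopology continuous_map_from_subtopology)
  then have "continuous_map ?R ?L (\<lambda>f. restrict f (topspace X))"
    by (rule continuous_map_into_compact_open)
  then have "continuous_map ?R ?L id"
    by (rule continuous_map_eq) (use ext in auto)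
  with 1 have "homeomorphic_maps ?R ?L id id"
    by (simp add: homeomorphic_maps_def)
  then show ?thesis
    by (simp add: homeomorphic_maps_id)
qed

lemma locally_compact_unit_interval: "locally_compact_space unit_interval" "Hausdorff_space unit_interval"
  by (simp_all add: compact_imp_locally_compact_space compact_space_subtopology Hausdorff_space_subtopology)

section \<open>Configuration spaces\<close>

lemma topspace_config_space:
  "topspace (config_space X n) = {A \<in> {1..n} \<rightarrow>\<^sub>E topspace X. inj_on A {1..n}}"
  by (auto simp: config_space_def)

lemma config_spaceD:
  assumes "A \<in> topspace (config_space X n)"
  shows "A \<in> extensional {1..n}" "inj_on A {1..n}"
  using assms unfolding topspace_config_space PiE_def by blast+

lemma continuous_map_into_config_space:
  "continuous_map T (config_space X n) f \<longleftrightarrow>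
     f \<in> topspace T \<rightarrow> extensional {1..n} \<and> (\<forall>s\<in>topspace T. inj_on (f s) {1..n}) \<and>
     (\<forall>i\<in>{1..n}. continuous_map T X (\<lambda>s. f s i))"
  by (auto simp: config_space_def continuous_map_in_subtopology continuous_map_componentwise)

lemma config_space_subtopology:
  "config_space (subtopology X S) n = subtopology (config_space X n) {A. \<forall>i\<in>{1..n}. A i \<in> S}"
  (is "?L = ?R")
proof -
  let ?P = "product_topology (\<lambda>_. X) {1..n}"
  have "topspace ?P \<inter> ({x. inj_on x {1..n}} \<inter> {A. \<forall>i\<in>{1..n}. A i \<in> S}) =
        topspace ?P \<inter> (({1..n} \<rightarrow>\<^sub>E S) \<inter> {x. inj_on x {1..n}})"
    by (auto simp: PiE_def Pi_def)
  then have "?R = subtopology (subtopology ?P ({1..n} \<rightarrow>\<^sub>E S)) {x. inj_on x {1..n}}"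
    unfolding config_space_def subtopology_subtopology
    using subtopology_restrict[of ?P] by (smt (verit))
  then show ?thesis
    by (simp add: config_space_def subtopology_product_topology)
qed

section \<open>Continuous families of homeomorphisms\<close>

text \<open>The inverses are carried along as data and are jointly continuous by definition, so
  inverse, composite and reparametrised families are again families without any further argument
  about inverses.\<close>

definition homeo_family ::
    "'p topology \<Rightarrow> ('p \<Rightarrow> 'a::topological_space \<Rightarrow> 'a) \<Rightarrow> ('p \<Rightarrow> 'a \<Rightarrow> 'a) \<Rightarrow> bool" where
  "homeo_family P \<phi> \<psi> \<longleftrightarrow>
     continuous_map (prod_topology P euclidean) euclidean (\<lambda>(p, x). \<phi> p x) \<and>
     continuous_map (prod_topology P euclidean) euclidean (\<lambda>(p, x). \<psi> p x) \<and>
     (\<forall>p\<in>topspace P. \<forall>x. \<psi> p (\<phi> p x) = x \<and> \<phi> p (\<psi> p x) = x)"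

lemma homeo_family_left_inverse:
    "homeo_family P \<phi> \<psi> \<Longrightarrow> p \<in> topspace P \<Longrightarrow> \<psi> p (\<phi> p x) = x"
  and homeo_family_right_inverse:
    "homeo_family P \<phi> \<psi> \<Longrightarrow> p \<in> topspace P \<Longrightarrow> \<phi> p (\<psi> p x) = x"
  by (auto simp: homeo_family_def)

lemma homeo_family_inj: "homeo_family P \<phi> \<psi> \<Longrightarrow> p \<in> topspace P \<Longrightarrow> inj (\<phi> p)"
  by (rule inj_on_inverseI) (rule homeo_family_left_inverse)

lemma homeo_family_inverse: "homeo_family P \<phi> \<psi> \<Longrightarrow> homeo_family P \<psi> \<phi>"
  by (auto simp: homeo_family_def)

lemma homeo_family_continuous:
  assumes "homeo_family P \<phi> \<psi>" "continuous_map T P p" "continuous_map T euclidean x"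
  shows "continuous_map T euclidean (\<lambda>z. \<phi> (p z) (x z))"
proof -
  have "continuous_map T euclidean ((\<lambda>(p, x). \<phi> p x) \<circ> (\<lambda>z. (p z, x z)))"
    using assms by (intro continuous_map_compose[of _ "prod_topology P euclidean"])
      (auto simp: homeo_family_def continuous_map_paired)
  then show ?thesis
    by (simp add: o_def)
qed

lemma homeo_family_compose:
  assumes "homeo_family P \<phi> \<psi>" "homeo_family P \<phi>' \<psi>'"
  shows "homeo_family P (\<lambda>p x. \<phi> p (\<phi>' p x)) (\<lambda>p x. \<psi>' p (\<psi> p x))"
proof -
  have "continuous_map (prod_topology P euclidean) euclidean (\<lambda>z. \<phi> (fst z) (\<phi>' (fst z) (snd z)))"
    by (intro homeo_family_continuous[OF assms(1)] homeo_family_continuous[OF assms(2)] continuous_intros)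
  moreover have "continuous_map (prod_topology P euclidean) euclidean (\<lambda>z. \<psi>' (fst z) (\<psi> (fst z) (snd z)))"
    by (intro homeo_family_continuous[OF homeo_family_inverse[OF assms(1)]]
        homeo_family_continuous[OF homeo_family_inverse[OF assms(2)]] continuous_intros)
  ultimately show ?thesis
    using assms by (simp add: homeo_family_def case_prod_unfold)
qed

lemma homeo_family_pullback:
  assumes f: "continuous_map Q P f" and \<phi>: "homeo_family P \<phi> \<psi>"
  shows "homeo_family Q (\<lambda>q. \<phi> (f q)) (\<lambda>q. \<psi> (f q))"
proof -
  have cf: "continuous_map (prod_topology Q euclidean) P (\<lambda>z. f (fst z))"
    using continuous_map_compose[OF continuous_map_fst f] by (simp add: o_def)
  have "continuous_map (prod_topology Q euclidean) euclidean (\<lambda>z. \<phi> (f (fst z)) (snd z))"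
    by (intro homeo_family_continuous[OF \<phi>] cf continuous_intros)
  moreover have "continuous_map (prod_topology Q euclidean) euclidean (\<lambda>z. \<psi> (f (fst z)) (snd z))"
    by (intro homeo_family_continuous[OF homeo_family_inverse[OF \<phi>]] cf continuous_intros)
  moreover have "f q \<in> topspace P" if "q \<in> topspace Q" for q
    using f that by (auto simp: continuous_map_def)
  ultimately show ?thesis
    using \<phi> by (simp add: homeo_family_def case_prod_unfold)
qed

lemma homeo_family_const:
  assumes "homeomorphism UNIV UNIV f g"
  shows "homeo_family P (\<lambda>_. f) (\<lambda>_. g)"
proof -
  have "continuous_map euclidean euclidean f" "continuous_map euclidean euclidean g"
    using assms by (auto simp: homeomorphism_def)
  from this[THEN continuous_map_compose[OF continuous_map_snd[of P]]] show ?thesis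
    using assms by (auto simp: homeo_family_def homeomorphism_def o_def case_prod_unfold)
qed

text \<open>Solving \<open>x + g p x = y\<close> for \<open>x\<close> means finding the fixed point
  of the contraction sending \<open>x\<close> to \<open>y - g p x\<close>. What remains is the
  continuity of the solution in \<open>p\<close> and \<open>y\<close> together.\<close>

lemma homeo_family_id_plus_contraction:
  fixes g :: "'p \<Rightarrow> 'a::banach \<Rightarrow> 'a"
  assumes g: "continuous_map (prod_topology P euclidean) euclidean (\<lambda>(p, x). g p x)"
    and lip: "\<And>p x y. p \<in> topspace P \<Longrightarrow> norm (g p x - g p y) \<le> norm (x - y) / 2"
  shows "\<exists>\<psi>. homeo_family P (\<lambda>p x. x + g p x) \<psi>"
proof -
  have ex: "\<exists>!x. x + g p x = y" if "p \<in> topspace P" for p y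
  proof -
    have "\<exists>!x. y - g p x = x"
      using lip[OF that] by (intro banach_fix_type[of "1/2"]) (auto simp: dist_norm norm_minus_commute)
    moreover have "y - g p x = x \<longleftrightarrow> x + g p x = y" for x
      by (auto simp: algebra_simps)
    ultimately show ?thesis
      by simp
  qed
  define \<psi> where "\<psi> p y = (THE x. x + g p x = y)" for p y
  have \<psi>: "\<psi> p y + g p (\<psi> p y) = y" if "p \<in> topspace P" for p y
    unfolding \<psi>_def using theI'[OF ex[OF that]] .
  have \<psi>': "\<psi> p (x + g p x) = x" if "p \<in> topspace P" for p x
    using ex[OF that] \<psi>[OF that] by blast
  \<comment> \<open>The identity plus a map of Lipschitz constant 1/2 shrinks distances by at most a
    factor 2.\<close>
  have expand: "norm (x - y) \<le> 2 * norm ((x + g p x) - (y + g p y))" if "p \<in> topspace P" for p x y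
    using lip[OF that, of x y] norm_triangle_ineq2[of "x - y" "g p y - g p x"]
    by (simp add: algebra_simps norm_minus_commute)
  have "continuous_map (prod_topology P euclidean) euclidean (\<lambda>z. snd z + (\<lambda>(p, x). g p x) z)"
    by (intro continuous_intros g)
  moreover have "continuous_map (prod_topology P euclidean) euclidean (\<lambda>(p, x). \<psi> p x)"
    unfolding continuous_map_atin limitin_canonical_iff
  proof
    fix w assume "w \<in> topspace (prod_topology P (euclidean :: 'a topology))"
    then obtain p y where w: "w = (p, y)" and p: "p \<in> topspace P"
      by auto
    let ?F = "atin (prod_topology P euclidean) (p, y)"
    \<comment> \<open>Comparing the solution at a nearby \<open>z\<close> with the old solution
      \<open>\<psi> p y\<close> through \<open>expand\<close> gives a bound in which only the old
      solution occurs. Its continuity therefore needs only that of \<open>g\<close>, and it vanishes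
      at \<open>(p, y)\<close>.\<close>
    let ?e = "\<lambda>z. 2 * norm (snd z - (\<psi> p y + (\<lambda>(q, x). g q x) (fst z, \<psi> p y)))"
    have "continuous_map (prod_topology P euclidean) euclidean ?e"
      by (intro continuous_intros continuous_map_compose[OF _ g, unfolded o_def]) simp_all
    then have "(?e \<longlongrightarrow> ?e (p, y)) ?F"
      using p by (simp only: continuous_map_atin limitin_canonical_iff) simp
    then have e: "(?e \<longlongrightarrow> 0) ?F"
      using \<psi>[OF p] by simp
    have "eventually (\<lambda>z. z \<in> topspace (prod_topology P euclidean)) ?F"
      unfolding eventually_atin using p by (auto intro!: exI[of _ "topspace (prod_topology P euclidean)"])
    then have "eventually (\<lambda>z. norm ((case z of (q, x) \<Rightarrow> \<psi> q x) - \<psi> p y) \<le> ?e z) ?F"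
    proof (rule eventually_mono)
      fix z assume "z \<in> topspace (prod_topology P (euclidean :: 'a topology))"
      then have "fst z \<in> topspace P"
        by auto
      from expand[OF this, of "\<psi> (fst z) (snd z)" "\<psi> p y"] \<psi>[OF this]
      show "norm ((case z of (q, x) \<Rightarrow> \<psi> q x) - \<psi> p y) \<le> ?e z"
        by (simp add: case_prod_unfold)
    qed
    then have "((\<lambda>z. (case z of (q, x) \<Rightarrow> \<psi> q x) - \<psi> p y) \<longlongrightarrow> 0) ?F"
      using e by (rule Lim_null_comparison)
    then show "((\<lambda>(q, x). \<psi> q x) \<longlongrightarrow> (case w of (q, x) \<Rightarrow> \<psi> q x)) (atin (prod_topology P euclidean) w)"
      by (simp add: LIM_zero_iff w)
  qed
  ultimately have "homeo_family P (\<lambda>p x. x + g p x) \<psi>"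
    using \<psi> \<psi>' by (simp add: homeo_family_def case_prod_unfold)
  then show ?thesis
    by blast
qed

section \<open>Bump pushes of finitely many points\<close>

text \<open>The coefficient of \<open>v j\<close> is the tent function of height 1 over the ball of
  radius \<rho> about \<open>a j\<close>. A tent, rather than a smooth bump, has the explicit
  Lipschitz constant 1/\<rho>.\<close>

definition bump_push :: "'i set \<Rightarrow> real \<Rightarrow> ('i \<Rightarrow> 'a) \<Rightarrow> ('i \<Rightarrow> 'a) \<Rightarrow> 'a \<Rightarrow> 'a::real_normed_vector" where
  "bump_push J \<rho> a v x = x + (\<Sum>j\<in>J. max 0 (1 - norm (x - a j) / \<rho>) *\<^sub>R v j)"

lemma bump_push_zero: "(\<And>j. j \<in> J \<Longrightarrow> v j = 0) \<Longrightarrow> bump_push J \<rho> a v x = x"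
  by (simp add: bump_push_def)

lemma bump_push_outside:
  assumes "\<rho> > 0" "\<And>j. j \<in> J \<Longrightarrow> \<rho> \<le> dist x (a j)"
  shows "bump_push J \<rho> a v x = x"
proof -
  have "max 0 (1 - norm (x - a j) / \<rho>) = 0" if "j \<in> J" for j
    using assms(1) assms(2)[OF that] by (simp add: dist_norm)
  then show ?thesis
    by (simp add: bump_push_def)
qed

text \<open>The other centres are at distance at least \<rho>, so their tents vanish at
  \<open>a j\<close>, whereas the tent of \<open>j\<close> itself has its peak there. The tents may
  still overlap elsewhere.\<close>

lemma bump_push_centre:
  assumes "finite J" "\<rho> > 0" "j \<in> J" "\<And>i. i \<in> J \<Longrightarrow> i \<noteq> j \<Longrightarrow> \<rho> \<le> dist (a j) (a i)"
  shows "bump_push J \<rho> a v (a j) = a j + v j"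
proof -
  have "(\<Sum>i\<in>J. max 0 (1 - norm (a j - a i) / \<rho>) *\<^sub>R v i) = (\<Sum>i\<in>J. if i = j then v i else 0)"
  proof (rule sum.cong)
    fix i assume "i \<in> J"
    then show "max 0 (1 - norm (a j - a i) / \<rho>) *\<^sub>R v i = (if i = j then v i else 0)"
      using assms(2) assms(4)[of i] by (auto simp: dist_norm max_def)
  qed simp
  then show ?thesis
    using assms by (simp add: bump_push_def)
qed

text \<open>The displacement has Lipschitz constant at most the sum of the
  \<open>norm (v p j)\<close> divided by \<rho>; the bound \<rho>/2 makes this 1/2, as inversion by
  contraction requires.\<close>

lemma homeo_family_bump_push:
  fixes a :: "'i \<Rightarrow> 'a::banach"
  assumes J: "finite J" and \<rho>: "\<rho> > 0"
    and v: "\<And>j. j \<in> J \<Longrightarrow> continuous_map P euclidean (\<lambda>p. v p j)"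
    and small: "\<And>p. p \<in> topspace P \<Longrightarrow> (\<Sum>j\<in>J. norm (v p j)) \<le> \<rho> / 2"
  shows "\<exists>\<psi>. homeo_family P (\<lambda>p. bump_push J \<rho> a (v p)) \<psi>"
proof -
  let ?b = "\<lambda>j x. max 0 (1 - norm (x - a j) / \<rho>)"
  have "continuous_map (prod_topology P euclidean) euclidean
          (\<lambda>z. \<Sum>j\<in>J. ?b j (snd z) *\<^sub>R v (fst z) j)"
  proof (intro continuous_map_sum J)
    fix j assume "j \<in> J"
    have "continuous_map (prod_topology P euclidean) euclidean (\<lambda>z. v (fst z) j)"
      using continuous_map_compose[OF continuous_map_fst v[OF \<open>j \<in> J\<close>]] by (simp add: o_def)
    moreover have "continuous_map (prod_topology P euclidean) euclidean (\<lambda>z. ?b j (snd z))"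
      using \<rho> by (intro continuous_intros) auto
    ultimately show "continuous_map (prod_topology P euclidean) euclidean
        (\<lambda>z. ?b j (snd z) *\<^sub>R v (fst z) j)"
      unfolding continuous_map_atin limitin_canonical_iff by (auto intro!: tendsto_scaleR)
  qed
  moreover have "norm ((\<Sum>j\<in>J. ?b j x *\<^sub>R v p j) - (\<Sum>j\<in>J. ?b j y *\<^sub>R v p j)) \<le> norm (x - y) / 2"
    if "p \<in> topspace P" for p x y
  proof -
    have b: "\<bar>?b j x - ?b j y\<bar> \<le> norm (x - y) / \<rho>" for j
    proof -
      have "\<bar>?b j x - ?b j y\<bar> \<le> \<bar>norm (x - a j) / \<rho> - norm (y - a j) / \<rho>\<bar>"
        by (auto simp: max_def)
      also have "\<dots> = \<bar>norm (x - a j) - norm (y - a j)\<bar> / \<rho>"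
        using \<rho> by (simp flip: diff_divide_distrib)
      also have "\<dots> \<le> norm (x - y) / \<rho>"
        using \<rho> norm_triangle_ineq3[of "x - a j" "y - a j"] by (intro divide_right_mono) auto
      finally show ?thesis .
    qed
    have "norm ((\<Sum>j\<in>J. ?b j x *\<^sub>R v p j) - (\<Sum>j\<in>J. ?b j y *\<^sub>R v p j))
        = norm (\<Sum>j\<in>J. (?b j x - ?b j y) *\<^sub>R v p j)"
      by (simp add: sum_subtractf scaleR_diff_left)
    also have "\<dots> \<le> (\<Sum>j\<in>J. (norm (x - y) / \<rho>) * norm (v p j))"
      by (intro order.trans[OF norm_sum] sum_mono) (simp only: norm_scaleR mult_right_mono[OF b norm_ge_zero])
    also have "\<dots> \<le> (norm (x - y) / \<rho>) * (\<rho> / 2)"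
      unfolding sum_distrib_left[symmetric] using \<rho> small[OF that] by (intro mult_left_mono) auto
    finally show ?thesis
      using \<rho> by simp
  qed
  ultimately show ?thesis
    unfolding bump_push_def by (intro homeo_family_id_plus_contraction) (simp_all add: case_prod_unfold)
qed

section \<open>Straightening a trajectory\<close>

lemma finite_set_separated:
  fixes S :: "'a::metric_space set"
  assumes "finite S"
  shows "\<exists>\<rho>>0. \<forall>x\<in>S. \<forall>y\<in>S. x \<noteq> y \<longrightarrow> \<rho> \<le> dist x y"
proof -
  \<comment> \<open>The extra element 1 keeps the set nonempty when \<open>S\<close> has at most one
    point, so that \<open>Min\<close> is meaningful.\<close>
  let ?D = "insert 1 ((\<lambda>(x, y). dist x y) ` {z \<in> S \<times> S. fst z \<noteq> snd z})"
  have "finite ?D"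
    using assms by auto
  then have "Min ?D > 0" "\<And>x y. x \<in> S \<Longrightarrow> y \<in> S \<Longrightarrow> x \<noteq> y \<Longrightarrow> Min ?D \<le> dist x y"
    by (auto intro!: Min_le image_eqI[where x="(_, _)"])
  then show ?thesis
    by blast
qed

text \<open>The bump pushes straighten a trajectory for a short time; the straightenings of adjacent
  time intervals are spliced by compactness.\<close>

lemma straighten_trajectory:
  fixes Y :: "real \<Rightarrow> 'i \<Rightarrow> 'a::banach"
  assumes J: "finite J" and "a \<le> b"
    and Y: "\<And>j. j \<in> J \<Longrightarrow> continuous_on {a..b} (\<lambda>t. Y t j)"
    and inj: "\<And>t. t \<in> {a..b} \<Longrightarrow> inj_on (Y t) J"
  shows "\<exists>\<phi> \<psi> k. homeo_family (top_of_set {a..b}) \<phi> \<psi> \<and> (\<forall>t\<in>{a..b}. \<forall>j\<in>J. \<phi> t (Y t j) = k j)"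
proof -
  \<comment> \<open>The \<open>Bolzano\<close> induction asks for short intervals around each point
    of \<open>{a..b}\<close>, and these may stick out of \<open>{a..b}\<close>. Hence
    \<open>Y\<close> is extended by its end values.\<close>
  define Z where "Z t = Y (max a (min b t))" for t
  have Z: "continuous_on UNIV (\<lambda>t. Z t j)" if "j \<in> J" for j
    unfolding Z_def using \<open>a \<le> b\<close>
    by (intro continuous_on_compose2[OF Y[OF that]] continuous_intros) auto
  have injZ: "inj_on (Z t) J" for t
    unfolding Z_def using \<open>a \<le> b\<close> by (intro inj) auto
  have "\<exists>\<phi> \<psi> k. homeo_family (top_of_set {a..b}) \<phi> \<psi> \<and> (\<forall>t\<in>{a..b}. \<forall>j\<in>J. \<phi> t (Z t j) = k j)"
    (is "?P a b")
    using \<open>a \<le> b\<close>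
  proof (induction rule: Bolzano)
    case (trans u v w)
    then obtain \<phi>1 \<psi>1 k1 where 1: "homeo_family (top_of_set {u..v}) \<phi>1 \<psi>1"
        "\<And>t j. t \<in> {u..v} \<Longrightarrow> j \<in> J \<Longrightarrow> \<phi>1 t (Z t j) = k1 j"
      by blast
    from trans obtain \<phi>2 \<psi>2 k2 where 2: "homeo_family (top_of_set {v..w}) \<phi>2 \<psi>2"
        "\<And>t j. t \<in> {v..w} \<Longrightarrow> j \<in> J \<Longrightarrow> \<phi>2 t (Z t j) = k2 j"
      by blast
    note le = \<open>u \<le> v\<close> \<open>v \<le> w\<close>
    \<comment> \<open>The spliced family is \<open>\<phi>1 (min t v)\<close> after
      \<open>\<psi>2 v\<close> after \<open>\<phi>2 (max t v)\<close>. Up to time \<open>v\<close>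
      the last two cancel. From then on \<open>\<phi>2\<close> brings \<open>Z t j\<close> to its
      constant position, \<open>\<psi>2 v\<close> takes that back to \<open>Z v j\<close>, and
      \<open>\<phi>1 v\<close> sends this to \<open>k1 j\<close>. Freezing by \<open>min\<close> and
      \<open>max\<close> makes the families continuous across \<open>v\<close>.\<close>
    have f1: "homeo_family (top_of_set {u..w}) (\<lambda>t. \<phi>1 (min t v)) (\<lambda>t. \<psi>1 (min t v))"
      by (rule homeo_family_pullback[OF _ 1(1)]) (use le in \<open>auto intro!: continuous_intros\<close>)
    have f2: "homeo_family (top_of_set {u..w}) (\<lambda>t. \<phi>2 (max t v)) (\<lambda>t. \<psi>2 (max t v))"
      by (rule homeo_family_pullback[OF _ 2(1)]) (use le in \<open>auto intro!: continuous_intros\<close>)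
    have f3: "homeo_family (top_of_set {u..w}) (\<lambda>t. \<psi>2 v) (\<lambda>t. \<phi>2 v)"
      by (rule homeo_family_pullback[OF _ homeo_family_inverse[OF 2(1)]]) (use le in auto)
    note homeo_family_compose[OF f1 homeo_family_compose[OF f3 f2]]
    moreover have "\<phi>1 (min t v) (\<psi>2 v (\<phi>2 (max t v) (Z t j))) = k1 j" if "t \<in> {u..w}" "j \<in> J" for t j
    proof (cases "t \<le> v")
      case True
      then show ?thesis
        using 1(2)[of t j] homeo_family_left_inverse[OF 2(1), of v] le that by (simp add: min_def max_def)
    next
      case False
      then have "\<phi>2 (max t v) (Z t j) = \<phi>2 v (Z v j)"
        using 2(2)[of t j] 2(2)[of v j] le that by (simp add: max_def)
      then show ?thesis
        using False 1(2)[of v j] homeo_family_left_inverse[OF 2(1), of v] le that by (simp add: min_def)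
    qed
    ultimately show ?case
      by blast
  next
    case (local s)
    obtain \<rho> where "\<rho> > 0" and sep: "\<forall>x\<in>Z s ` J. \<forall>y\<in>Z s ` J. x \<noteq> y \<longrightarrow> \<rho> \<le> dist x y"
      using finite_set_separated[of "Z s ` J"] J by blast
    have \<rho>: "\<rho> \<le> dist (Z s i) (Z s j)" if "i \<in> J" "j \<in> J" "i \<noteq> j" for i j
      using \<open>\<rho> > 0\<close> sep inj_onD[OF injZ[of s], of i j] that by auto
    have "isCont (\<lambda>t. \<Sum>j\<in>J. norm (Z t j - Z s j)) s"
      using Z by (intro continuous_intros) (auto simp: continuous_on_eq_continuous_at)
    then have "\<exists>d>0. \<forall>t. dist t s < d \<longrightarrow> dist (\<Sum>j\<in>J. norm (Z t j - Z s j)) (\<Sum>j\<in>J. norm (Z s j - Z s j)) < \<rho> / 2"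
      unfolding continuous_at_eps_delta using \<open>\<rho> > 0\<close> half_gt_zero by blast
    then obtain d where "d > 0"
      and d': "\<And>t. dist t s < d \<Longrightarrow> dist (\<Sum>j\<in>J. norm (Z t j - Z s j)) (\<Sum>j\<in>J. norm (Z s j - Z s j)) < \<rho> / 2"
      by blast
    have d: "(\<Sum>j\<in>J. norm (Z t j - Z s j)) \<le> \<rho> / 2" if "\<bar>t - s\<bar> < d" for t
      using d'[of t] that by (simp add: dist_real_def)
    have "?P u v" if uv: "u \<le> s \<and> s \<le> v \<and> v - u < d" for u v
    proof -
      \<comment> \<open>The push goes from the fixed positions \<open>Z s\<close> to the moving
        ones, so that its centres and radius do not depend on time; the straightening is its
        inverse.\<close>
      have "\<exists>\<psi>. homeo_family (top_of_set {u..v}) (\<lambda>t. bump_push J \<rho> (Z s) (\<lambda>j. Z t j - Z s j)) \<psi>"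
      proof (rule homeo_family_bump_push[OF J \<open>\<rho> > 0\<close>])
        show "continuous_map (top_of_set {u..v}) euclidean (\<lambda>t. Z t j - Z s j)" if "j \<in> J" for j
          using Z[OF that] by (auto intro!: continuous_intros intro: continuous_on_subset)
        show "(\<Sum>j\<in>J. norm (Z t j - Z s j)) \<le> \<rho> / 2" if "t \<in> topspace (top_of_set {u..v})" for t
          using that uv by (intro d) auto
      qed
      then obtain \<psi> where \<psi>: "homeo_family (top_of_set {u..v}) (\<lambda>t. bump_push J \<rho> (Z s) (\<lambda>j. Z t j - Z s j)) \<psi>" ..
      have "\<psi> t (Z t j) = Z s j" if "t \<in> {u..v}" "j \<in> J" for t j
      proof -
        have "bump_push J \<rho> (Z s) (\<lambda>j. Z t j - Z s j) (Z s j) = Z t j"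
          using bump_push_centre[OF J \<open>\<rho> > 0\<close> that(2), of "Z s" "\<lambda>j. Z t j - Z s j"] \<rho> that(2) by simp
        then show ?thesis
          using homeo_family_left_inverse[OF \<psi>, of t "Z s j"] that by simp
      qed
      then show ?thesis
        using homeo_family_inverse[OF \<psi>] by blast
    qed
    then show ?case
      using \<open>d > 0\<close> by blast
  qed
  moreover have "Z t = Y t" if "t \<in> {a..b}" for t
    using that by (simp add: Z_def)
  ultimately show ?thesis
    by simp
qed

section \<open>Fibrewise homeomorphisms and local triviality\<close>

lemma homeomorphic_maps_points:
  assumes "homeomorphic_maps X Y f g"
  shows "x \<in> topspace X \<Longrightarrow> f x \<in> topspace Y" "x \<in> topspace X \<Longrightarrow> g (f x) = x"
    "y \<in> topspace Y \<Longrightarrow> g y \<in> topspace X" "y \<in> topspace Y \<Longrightarrow> f (g y) = y"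
  using assms continuous_map_image_subset_topspace unfolding homeomorphic_maps_def by blast+

definition fibrewise_homeomorphic ::
    "'e topology \<Rightarrow> 'b topology \<Rightarrow> ('e \<Rightarrow> 'b) \<Rightarrow> 'f topology \<Rightarrow> 'c topology \<Rightarrow> ('f \<Rightarrow> 'c) \<Rightarrow> bool" where
  "fibrewise_homeomorphic E B p E' B' p' \<longleftrightarrow>
     (\<exists>F G. homeomorphic_map E E' F \<and> homeomorphic_map B B' G \<and> (\<forall>x\<in>topspace E. p' (F x) = G (p x)))"

lemma fibrewise_homeomorphicE:
  assumes "fibrewise_homeomorphic E B p E' B' p'"
  obtains F F' G G' where "homeomorphic_maps E E' F F'" "homeomorphic_maps B B' G G'"
    "\<And>x. x \<in> topspace E \<Longrightarrow> p' (F x) = G (p x)"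
  using assms unfolding fibrewise_homeomorphic_def homeomorphic_map_maps by (elim exE conjE) (rule that, assumption, assumption, simp)

lemma fibrewise_homeomorphicI:
  assumes "homeomorphic_maps E E' F F'" "homeomorphic_maps B B' G G'"
    "\<And>x. x \<in> topspace E \<Longrightarrow> p' (F x) = G (p x)"
  shows "fibrewise_homeomorphic E B p E' B' p'"
  unfolding fibrewise_homeomorphic_def homeomorphic_map_maps
  using assms by (intro exI[of _ F] exI[of _ G] conjI ballI exI[of _ F'] exI[of _ G'])

text \<open>\<open>G'\<close> undoes \<open>G\<close> only on points of \<open>B\<close>, which is
  why \<open>p\<close> is required to take its values there.\<close>

lemma fibrewise_homeomorphic_sym:
  assumes "fibrewise_homeomorphic E B p E' B' p'" and p: "p \<in> topspace E \<rightarrow> topspace B"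
  shows "fibrewise_homeomorphic E' B' p' E B p"
  using assms(1)
proof (rule fibrewise_homeomorphicE)
  fix F F' G G'
  assume F: "homeomorphic_maps E E' F F'" and G: "homeomorphic_maps B B' G G'"
    and FG: "\<And>x. x \<in> topspace E \<Longrightarrow> p' (F x) = G (p x)"
  show ?thesis
  proof (rule fibrewise_homeomorphicI)
    show "homeomorphic_maps E' E F' F" "homeomorphic_maps B' B G' G"
      using F G homeomorphic_maps_sym by blast+
    fix y assume y: "y \<in> topspace E'"
    have "F' y \<in> topspace E" "F (F' y) = y"
      using homeomorphic_maps_points[OF F] y by auto
    then have "p (F' y) \<in> topspace B" "p' y = G (p (F' y))"
      using FG[of "F' y"] p by auto
    then show "p (F' y) = G' (p' y)"
      using homeomorphic_maps_points(2)[OF G] by simp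
  qed
qed

lemma fibrewise_homeomorphic_trans:
  assumes "fibrewise_homeomorphic E B p E' B' p'" "fibrewise_homeomorphic E' B' p' E'' B'' p''"
  shows "fibrewise_homeomorphic E B p E'' B'' p''"
proof -
  obtain F G where 1: "homeomorphic_map E E' F" "homeomorphic_map B B' G"
      "\<And>x. x \<in> topspace E \<Longrightarrow> p' (F x) = G (p x)"
    using assms(1) unfolding fibrewise_homeomorphic_def by (elim exE conjE) (rule that, assumption, assumption, simp)
  obtain F' G' where 2: "homeomorphic_map E' E'' F'" "homeomorphic_map B' B'' G'"
      "\<And>x. x \<in> topspace E' \<Longrightarrow> p'' (F' x) = G' (p' x)"
    using assms(2) unfolding fibrewise_homeomorphic_def by (elim exE conjE) (rule that, assumption, assumption, simp)
  have "F x \<in> topspace E'" if "x \<in> topspace E" for x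
    using 1(1) that homeomorphic_imp_surjective_map by blast
  then show ?thesis
    unfolding fibrewise_homeomorphic_def
    using homeomorphic_map_compose[OF 1(1) 2(1)] homeomorphic_map_compose[OF 1(2) 2(2)] 1(3) 2(3)
    by (intro exI[of _ "F' \<circ> F"] exI[of _ "G' \<circ> G"]) simp
qed

section \<open>Invariance of the Schwarz genus\<close>

definition sectional_cover :: "'e topology \<Rightarrow> 'b topology \<Rightarrow> ('e \<Rightarrow> 'b) \<Rightarrow> nat \<Rightarrow> (nat \<Rightarrow> 'b set) \<Rightarrow> bool" where
  "sectional_cover E B p k U \<longleftrightarrow> (\<Union>i\<in>{1..k}. U i) = topspace B \<and>
     (\<forall>i\<in>{1..k}. openin B (U i) \<and>
        (\<exists>s. continuous_map (subtopology B (U i)) E s \<and> (\<forall>y\<in>U i. p (s y) = y)))"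

lemma schwarz_genus_sectional_cover:
  "schwarz_genus E B p = Inf {enat k |k. \<exists>U. sectional_cover E B p k U}"
  unfolding schwarz_genus_def sectional_cover_def ..

text \<open>Pulling a cover back along \<open>G'\<close> and conjugating its sections to
  \<open>F \<circ> (s \<circ> G')\<close> keeps the number of open sets. So every \<open>k\<close>
  admissible for \<open>p\<close> is admissible for \<open>p'\<close>, and the infimum over the
  larger set is at most the other, also when it is infinite.\<close>

lemma schwarz_genus_le_fibrewise_homeomorphic:
  assumes "fibrewise_homeomorphic E B p E' B' p'"
  shows "schwarz_genus E' B' p' \<le> schwarz_genus E B p"
  using assms
proof (rule fibrewise_homeomorphicE)
  fix F F' G G'
  assume F: "homeomorphic_maps E E' F F'" and G: "homeomorphic_maps B B' G G'"
    and FG: "\<And>x. x \<in> topspace E \<Longrightarrow> p' (F x) = G (p x)"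
  have "sectional_cover E' B' p' k (\<lambda>i. {y \<in> topspace B'. G' y \<in> U i})"
    if "sectional_cover E B p k U" for k :: nat and U
    unfolding sectional_cover_def
  proof (intro conjI ballI)
    have U: "(\<Union>i\<in>{1..k}. U i) = topspace B" "\<And>i. i \<in> {1..k} \<Longrightarrow> openin B (U i) \<and>
           (\<exists>s. continuous_map (subtopology B (U i)) E s \<and> (\<forall>y\<in>U i. p (s y) = y))"
      using that unfolding sectional_cover_def by auto
    let ?U' = "\<lambda>i. {y \<in> topspace B'. G' y \<in> U i}"
    show "(\<Union>i\<in>{1..k}. ?U' i) = topspace B'"
      using U(1) homeomorphic_maps_points(3)[OF G] by blast
    fix i assume i: "i \<in> {1..k}"
    have cG: "continuous_map B' B G'"
      using G by (simp add: homeomorphic_maps_def)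
    then show "openin B' (?U' i)"
      using U(2)[OF i] by (intro openin_continuous_map_preimage) auto
    obtain s where s: "continuous_map (subtopology B (U i)) E s" "\<And>y. y \<in> U i \<Longrightarrow> p (s y) = y"
      using U(2)[OF i] by blast
    have "U i \<subseteq> topspace B"
      using U(2)[OF i] openin_subset by blast
    have "continuous_map (subtopology B' (?U' i)) (subtopology B (U i)) G'"
      using cG by (auto simp: continuous_map_in_subtopology continuous_map_from_subtopology)
    then have "continuous_map (subtopology B' (?U' i)) E' (F \<circ> (s \<circ> G'))"
      using s(1) F unfolding homeomorphic_maps_def by (meson continuous_map_compose)
    moreover have "p' ((F \<circ> (s \<circ> G')) y) = y" if "y \<in> ?U' i" for y
    proof -
      have y: "y \<in> topspace B'" "G' y \<in> U i"
        using that by auto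
      have "s (G' y) \<in> topspace E"
        using s(1) y(2) \<open>U i \<subseteq> topspace B\<close> by (auto simp: continuous_map_def)
      then have "p' (F (s (G' y))) = G (G' y)"
        using FG s(2)[OF y(2)] by simp
      then show ?thesis
        using G y by (simp add: homeomorphic_maps_def)
    qed
    ultimately show "\<exists>s. continuous_map (subtopology B' (?U' i)) E' s \<and> (\<forall>y\<in>?U' i. p' (s y) = y)"
      by blast
  qed
  then show ?thesis
    unfolding schwarz_genus_sectional_cover by (intro Inf_superset_mono) blast
qed

lemma schwarz_genus_fibrewise_homeomorphic:
  assumes "fibrewise_homeomorphic E B p E' B' p'" "p \<in> topspace E \<rightarrow> topspace B"
  shows "schwarz_genus E B p = schwarz_genus E' B' p'"
  using schwarz_genus_le_fibrewise_homeomorphic[OF assms(1)]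
    schwarz_genus_le_fibrewise_homeomorphic[OF fibrewise_homeomorphic_sym[OF assms]]
  by (rule antisym[rotated])

section \<open>Transport of local triviality and the common fibre\<close>

text \<open>The typical fibre is kept and only the charts are conjugated. As the definition places
  the fibre on the type of the total space, both total spaces are taken over the same type.\<close>

lemma locally_trivial_fibration_fibrewise_homeomorphic:
  fixes E E' :: "'e topology"
  assumes triv: "locally_trivial_fibration E B p" and hom: "fibrewise_homeomorphic E B p E' B' p'"
  shows "locally_trivial_fibration E' B' p'"
  using hom
proof (rule fibrewise_homeomorphicE)
  fix F F' G G'
  assume F: "homeomorphic_maps E E' F F'" and G: "homeomorphic_maps B B' G G'"
    and FG: "\<And>x. x \<in> topspace E \<Longrightarrow> p' (F x) = G (p x)"
  have p: "continuous_map E B p"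
    using triv by (simp add: locally_trivial_fibration_def)
  note F' = homeomorphic_maps_points(3,4)[OF F] and G' = homeomorphic_maps_points(3,4)[OF G]
  have "continuous_map E' B' (G \<circ> (p \<circ> F'))"
    using F G p unfolding homeomorphic_maps_def by (meson continuous_map_compose)
  then have cont: "continuous_map E' B' p'"
    by (rule continuous_map_eq) (use F' FG in force)
  obtain T :: "'e topology" where T: "\<And>b. b \<in> topspace B \<Longrightarrow> \<exists>U h. openin B U \<and> b \<in> U \<and>
        homeomorphic_map (prod_topology (subtopology B U) T) (subtopology E {x \<in> topspace E. p x \<in> U}) h \<and>
        (\<forall>u\<in>U. \<forall>v\<in>topspace T. p (h (u, v)) = u)"
    using triv unfolding locally_trivial_fibration_def by blast
  show ?thesis
    unfolding locally_trivial_fibration_def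
  proof (intro conjI exI[of _ T] ballI cont)
    fix b' assume b': "b' \<in> topspace B'"
    then obtain U h where U: "openin B U" "G' b' \<in> U"
      and h: "homeomorphic_map (prod_topology (subtopology B U) T) (subtopology E {x \<in> topspace E. p x \<in> U}) h"
      and ph: "\<And>u v. u \<in> U \<Longrightarrow> v \<in> topspace T \<Longrightarrow> p (h (u, v)) = u"
      using T[OF G'(1)[OF b']] by blast
    let ?U' = "{y \<in> topspace B'. G' y \<in> U}"
    \<comment> \<open>The old chart, with its base coordinate read through \<open>G'\<close> and its
      values carried over by \<open>F\<close>.\<close>
    let ?h' = "F \<circ> (h \<circ> (\<lambda>(u, v). (G' u, id v)))"
    have "U \<subseteq> topspace B"
      using U(1) openin_subset by blast
    have "openin B' ?U'"
      using G U(1) by (intro openin_continuous_map_preimage) (auto simp: homeomorphic_maps_def)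
    have "homeomorphic_maps (subtopology B' ?U') (subtopology B U) G' G"
      by (rule homeomorphic_maps_subtopologies_alt[OF homeomorphic_maps_sym[THEN iffD1, OF G]])
        (auto simp: homeomorphic_maps_points[OF G])
    moreover have "homeomorphic_maps T T id id"
      by (simp add: homeomorphic_maps_id)
    ultimately have "homeomorphic_maps (prod_topology (subtopology B' ?U') T) (prod_topology (subtopology B U) T)
        (\<lambda>(u, v). (G' u, id v)) (\<lambda>(u, v). (G u, id v))"
      by (subst homeomorphic_maps_prod) blast
    then have 1: "homeomorphic_map (prod_topology (subtopology B' ?U') T) (prod_topology (subtopology B U) T)
        (\<lambda>(u, v). (G' u, id v))"
      using homeomorphic_map_maps by blast
    have mem: "p x \<in> topspace B" "G' (G (p x)) = p x" "G (p x) \<in> topspace B'" if "x \<in> topspace E" for x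
      using G p that by (auto simp: homeomorphic_maps_def continuous_map_def)
    have 2: "homeomorphic_map (subtopology E {x \<in> topspace E. p x \<in> U}) (subtopology E' {y \<in> topspace E'. p' y \<in> ?U'}) F"
      by (rule homeomorphic_map_subtopologies_alt) (use F homeomorphic_map_maps FG mem in auto)
    have hom: "homeomorphic_map (prod_topology (subtopology B' ?U') T) (subtopology E' {y \<in> topspace E'. p' y \<in> ?U'}) ?h'"
      by (intro homeomorphic_map_compose[OF _ 2] homeomorphic_map_compose[OF 1 h])
    have "p' (?h' (u, v)) = u" if "u \<in> ?U'" "v \<in> topspace T" for u v
    proof -
      have "h (G' u, v) \<in> topspace E"
        using homeomorphic_imp_continuous_map[OF h] that \<open>U \<subseteq> topspace B\<close> by (auto simp: continuous_map_def)
      then show ?thesis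
        using FG ph that G'(2) by simp
    qed
    then show "\<exists>U h. openin B' U \<and> b' \<in> U \<and>
        homeomorphic_map (prod_topology (subtopology B' U) T) (subtopology E' {y \<in> topspace E'. p' y \<in> U}) h \<and>
        (\<forall>u\<in>U. \<forall>v\<in>topspace T. p' (h (u, v)) = u)"
      using \<open>openin B' ?U'\<close> b' U(2) hom by blast
  qed
qed

text \<open>Fibres over nearby points are homeomorphic, hence over a connected base all fibres are.\<close>

lemma locally_trivial_fibration_connected_base:
  assumes p: "continuous_map E B p" and B: "connected_space B"
    and triv: "\<And>b. b \<in> topspace B \<Longrightarrow> \<exists>U h. openin B U \<and> b \<in> U \<and>
        homeomorphic_map (prod_topology (subtopology B U) (subtopology E {x \<in> topspace E. p x = b}))
          (subtopology E {x \<in> topspace E. p x \<in> U}) h \<and>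
        (\<forall>u\<in>U. \<forall>v\<in>topspace E. p v = b \<longrightarrow> p (h (u, v)) = u)"
  shows "locally_trivial_fibration E B p"
proof (cases "topspace B = {}")
  case True
  then show ?thesis
    using p by (simp add: locally_trivial_fibration_def)
next
  case False
  then obtain b\<^sub>0 where b\<^sub>0: "b\<^sub>0 \<in> topspace B"
    by blast
  let ?Fib = "\<lambda>b. subtopology E {x \<in> topspace E. p x = b}"
  \<comment> \<open>Restricting a chart around \<open>b\<close> to the slice over \<open>u\<close>
    gives a homeomorphism from the fibre over \<open>b\<close> onto the fibre over \<open>u\<close>;
    its inverse is the second component of the inverse chart.\<close>
  have near: "\<exists>U. openin B U \<and> b \<in> U \<and> (\<forall>u\<in>U. ?Fib b homeomorphic_space ?Fib u)"
    if bB: "b \<in> topspace B" for b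
  proof -
    obtain U h where U: "openin B U" "b \<in> U"
      and h: "homeomorphic_map (prod_topology (subtopology B U) (?Fib b))
          (subtopology E {x \<in> topspace E. p x \<in> U}) h"
      and ph: "\<forall>u\<in>U. \<forall>v\<in>topspace E. p v = b \<longrightarrow> p (h (u, v)) = u"
      using triv[OF bB] by (elim exE conjE)
    note ph = ph[rule_format]
    obtain k where hk: "homeomorphic_maps (prod_topology (subtopology B U) (?Fib b))
          (subtopology E {x \<in> topspace E. p x \<in> U}) h k"
      using h homeomorphic_map_maps by blast
    have "?Fib b homeomorphic_space ?Fib u" if u: "u \<in> U" for u
    proof -
      have uB: "u \<in> topspace B"
        using U(1) u openin_subset by blast
      have ch: "continuous_map (prod_topology (subtopology B U) (?Fib b)) E h"
        and ck: "continuous_map (subtopology E {x \<in> topspace E. p x \<in> U}) (prod_topology (subtopology B U) (?Fib b)) k"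
        using hk by (auto simp: homeomorphic_maps_def continuous_map_in_subtopology)
      have kh: "k (h (u, v)) = (u, v)" if "v \<in> topspace (?Fib b)" for v
        using hk that u uB by (simp add: homeomorphic_maps_def)
      have k: "k x = (u, snd (k x)) \<and> snd (k x) \<in> topspace (?Fib b) \<and> h (u, snd (k x)) = x"
        if "x \<in> topspace (?Fib u)" for x
      proof -
        have x: "x \<in> topspace (subtopology E {x \<in> topspace E. p x \<in> U})" "p x = u"
          using that u by auto
        then have "k x \<in> topspace (prod_topology (subtopology B U) (?Fib b))" "h (k x) = x"
          using hk by (auto simp: homeomorphic_maps_def continuous_map_def)
        then show ?thesis
          using ph[of "fst (k x)" "snd (k x)"] x(2) by (cases "k x") auto
      qed
      have "continuous_map (?Fib b) (?Fib u) (\<lambda>v. h (u, v))"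
      proof -
        have "continuous_map (?Fib b) (prod_topology (subtopology B U) (?Fib b)) (\<lambda>v. (u, v))"
          using u uB by (simp add: continuous_map_paired)
        then have "continuous_map (?Fib b) E (h \<circ> (\<lambda>v. (u, v)))"
          using ch continuous_map_compose by blast
        moreover from this have "h (u, v) \<in> topspace E" if "v \<in> topspace (?Fib b)" for v
          using that by (auto simp: continuous_map_def)
        ultimately show ?thesis
          using ph[OF u] by (auto simp: continuous_map_in_subtopology o_def)
      qed
      moreover have "continuous_map (?Fib u) (?Fib b) (\<lambda>x. snd (k x))"
      proof -
        have "?Fib u = subtopology (subtopology E {x \<in> topspace E. p x \<in> U}) {x \<in> topspace E. p x = u}"
          using u by (auto simp: subtopology_subtopology intro!: arg_cong[where f="subtopology E"])
        then have "continuous_map (?Fib u) (prod_topology (subtopology B U) (?Fib b)) k"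
          using continuous_map_from_subtopology[OF ck] by simp
        then show ?thesis
          by (simp add: continuous_map_pairwise o_def)
      qed
      moreover have "snd (k (h (u, v))) = v" if "v \<in> topspace (?Fib b)" for v
        using kh[OF that] by simp
      moreover have "h (u, snd (k x)) = x" if "x \<in> topspace (?Fib u)" for x
        using k[OF that] by blast
      ultimately have "homeomorphic_maps (?Fib b) (?Fib u) (\<lambda>v. h (u, v)) (\<lambda>x. snd (k x))"
        unfolding homeomorphic_maps_def by blast
      then show ?thesis
        by (rule homeomorphic_maps_imp_homeomorphic_space)
    qed
    with U show ?thesis
      by blast
  qed
  \<comment> \<open>Being homeomorphic to the fibre over \<open>b\<^sub>0\<close> is, by
    \<open>near\<close>, a locally constant property of the base point. Hence \<open>S\<close> is
    open and closed, and it contains \<open>b\<^sub>0\<close>.\<close>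
  define S where "S = {b \<in> topspace B. ?Fib b\<^sub>0 homeomorphic_space ?Fib b}"
  have "\<exists>U. openin B U \<and> b \<in> U \<and> U \<subseteq> S" if b: "b \<in> S" for b
  proof -
    obtain U where U: "openin B U" "b \<in> U" "\<And>u. u \<in> U \<Longrightarrow> ?Fib b homeomorphic_space ?Fib u"
      using near[of b] b S_def by blast
    moreover have "?Fib b\<^sub>0 homeomorphic_space ?Fib b"
      using b by (simp add: S_def)
    then have "U \<subseteq> S"
      using U openin_subset[OF U(1)] homeomorphic_space_trans unfolding S_def by blast
    ultimately show ?thesis
      by blast
  qed
  then have "openin B S"
    by (subst openin_subopen) blast
  moreover have "\<exists>U. openin B U \<and> b \<in> U \<and> U \<subseteq> topspace B - S" if b: "b \<in> topspace B - S" for b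
  proof -
    obtain U where U: "openin B U" "b \<in> U" "\<And>u. u \<in> U \<Longrightarrow> ?Fib b homeomorphic_space ?Fib u"
      using near[of b] b by blast
    moreover have "\<not> ?Fib b\<^sub>0 homeomorphic_space ?Fib b"
      using b by (simp add: S_def)
    then have "u \<notin> S" if "u \<in> U" for u
      using U(3)[OF that] homeomorphic_space_trans homeomorphic_space_sym unfolding S_def by blast
    ultimately show ?thesis
      using openin_subset[OF U(1)] by blast
  qed
  then have "openin B (topspace B - S)"
    by (subst openin_subopen) blast
  moreover have "b\<^sub>0 \<in> S"
    using b\<^sub>0 by (simp add: S_def homeomorphic_space_refl)
  ultimately have S: "S = topspace B"
    using B unfolding connected_space_clopen_in closedin_def S_def by blast
  show ?thesis
    unfolding locally_trivial_fibration_def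
  proof (intro conjI exI[of _ "?Fib b\<^sub>0"] ballI p)
    fix b assume b: "b \<in> topspace B"
    then obtain U h where U: "openin B U" "b \<in> U"
      and h: "homeomorphic_map (prod_topology (subtopology B U) (?Fib b))
          (subtopology E {x \<in> topspace E. p x \<in> U}) h"
      and ph: "\<And>u v. u \<in> U \<Longrightarrow> v \<in> topspace E \<Longrightarrow> p v = b \<Longrightarrow> p (h (u, v)) = u"
      using triv[of b] b by blast
    \<comment> \<open>Precomposing the chart at \<open>b\<close> with this identification replaces
      the fibre over \<open>b\<close> by the common fibre over \<open>b\<^sub>0\<close> and leaves
      the base coordinate alone.\<close>
    obtain f g where fg: "homeomorphic_maps (?Fib b\<^sub>0) (?Fib b) f g"
      using b S unfolding S_def homeomorphic_space_def by blast
    have "homeomorphic_maps (subtopology B U) (subtopology B U) id id"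
      by (simp add: homeomorphic_maps_id)
    with fg have "homeomorphic_maps (prod_topology (subtopology B U) (?Fib b\<^sub>0))
        (prod_topology (subtopology B U) (?Fib b)) (\<lambda>(u, v). (id u, f v)) (\<lambda>(u, v). (id u, g v))"
      by (subst homeomorphic_maps_prod) blast
    then have hom: "homeomorphic_map (prod_topology (subtopology B U) (?Fib b\<^sub>0))
        (subtopology E {x \<in> topspace E. p x \<in> U}) (h \<circ> (\<lambda>(u, v). (id u, f v)))"
      using h homeomorphic_map_compose homeomorphic_map_maps by blast
    have "p ((h \<circ> (\<lambda>(u, v). (id u, f v))) (u, v)) = u" if "u \<in> U" "v \<in> topspace (?Fib b\<^sub>0)" for u v
    proof -
      have "f v \<in> topspace (?Fib b)"
        using fg that(2) by (auto simp: homeomorphic_maps_def continuous_map_def)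
      then show ?thesis
        using ph[OF that(1)] by simp
    qed
    then show "\<exists>U h. openin B U \<and> b \<in> U \<and>
        homeomorphic_map (prod_topology (subtopology B U) (?Fib b\<^sub>0)) (subtopology E {x \<in> topspace E. p x \<in> U}) h \<and>
        (\<forall>u\<in>U. \<forall>v\<in>topspace (?Fib b\<^sub>0). p (h (u, v)) = u)"
      using U hom by blast
  qed
qed

section \<open>Ambient isotopies acting on paths of configurations\<close>

lemma topspace_E_space:
  "\<gamma> \<in> topspace (E_space n m Y) \<longleftrightarrow> \<gamma> \<in> extensional {0..1} \<and>
     continuous_map unit_interval (config_space euclidean n) \<gamma> \<and> (\<forall>t\<in>{0..1}. config_avoids n m (\<gamma> t) (Y t))"
  by (auto simp: E_space_def path_space_def cont_maps_def)

lemma topspace_B_space: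
  "(A, B) \<in> topspace (B_space n m Y) \<longleftrightarrow>
     A \<in> topspace (config_space euclidean n) \<and> config_avoids n m A (Y 0) \<and>
     B \<in> topspace (config_space euclidean n) \<and> config_avoids n m B (Y 1)"
  by (auto simp: B_space_def)

lemma continuous_map_E_space_apply:
  "continuous_map (prod_topology (E_space n m Y) unit_interval) (config_space euclidean n) (\<lambda>(\<gamma>, t). \<gamma> t)"
proof -
  have "continuous_map (prod_topology (path_space (config_space euclidean n)) unit_interval)
      (config_space euclidean n) (\<lambda>(\<gamma>, t). \<gamma> t)"
    unfolding path_space_def
    by (intro continuous_map_compact_open_apply locally_compact_unit_interval disjI1)
  then show ?thesis
    unfolding E_space_def by (subst prod_topology_subtopology(1)) (rule continuous_map_from_subtopology)
qed

lemma continuous_map_into_E_space: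
  assumes g: "continuous_map (prod_topology T unit_interval) (config_space euclidean n) (\<lambda>(s, t). g s t)"
    and avoid: "\<And>s t. s \<in> topspace T \<Longrightarrow> t \<in> {0..1} \<Longrightarrow> config_avoids n m (g s t) (Y t)"
  shows "continuous_map T (E_space n m Y) (\<lambda>s. restrict (g s) {0..1})"
proof -
  have "continuous_map T (path_space (config_space euclidean n)) (\<lambda>s. restrict (g s) {0..1})"
    using continuous_map_into_compact_open[OF g] by (simp add: path_space_def)
  then show ?thesis
    using avoid by (auto simp: E_space_def continuous_map_in_subtopology)
qed

lemma continuous_map_E_space_at:
  assumes "t \<in> {0..1}"
  shows "continuous_map (E_space n m Y) (config_space euclidean n) (\<lambda>\<gamma>. \<gamma> t)"
proof -
  have "continuous_map (E_space n m Y) (prod_topology (E_space n m Y) unit_interval) (\<lambda>\<gamma>. (\<gamma>, t))"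
    using assms by (simp add: continuous_map_paired continuous_map_id[unfolded id_def])
  from continuous_map_compose[OF this continuous_map_E_space_apply] show ?thesis
    by (simp add: o_def)
qed

lemma continuous_map_endpoints: "continuous_map (E_space n m Y) (B_space n m Y) endpoints"
proof -
  have "continuous_map (E_space n m Y) (prod_topology (config_space euclidean n) (config_space euclidean n)) endpoints"
    unfolding endpoints_def[abs_def] by (intro continuous_map_pairedI continuous_map_E_space_at) auto
  then show ?thesis
    by (auto simp: B_space_def continuous_map_in_subtopology endpoints_def topspace_E_space)
qed

definition config_act :: "nat \<Rightarrow> ('a \<Rightarrow> 'a) \<Rightarrow> (nat \<Rightarrow> 'a) \<Rightarrow> nat \<Rightarrow> 'a" where
  "config_act n f A = (\<lambda>i\<in>{1..n}. f (A i))"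

definition path_act :: "nat \<Rightarrow> (real \<Rightarrow> 'a \<Rightarrow> 'a) \<Rightarrow> (real \<Rightarrow> nat \<Rightarrow> 'a) \<Rightarrow> real \<Rightarrow> nat \<Rightarrow> 'a" where
  "path_act n f \<gamma> = (\<lambda>t\<in>{0..1}. config_act n (f t) (\<gamma> t))"

lemma endpoints_path_act:
  "endpoints (path_act n f \<gamma>) = (config_act n (f 0) (\<gamma> 0), config_act n (f 1) (\<gamma> 1))"
  by (simp add: endpoints_def path_act_def)

lemma config_act_inverse:
  assumes "A \<in> topspace (config_space X n)" "\<And>x. g (f x) = x"
  shows "config_act n g (config_act n f A) = A"
  using assms by (auto simp: config_act_def topspace_config_space PiE_def extensional_def fun_eq_iff)

lemma path_act_inverse:
  assumes "\<gamma> \<in> topspace (E_space n m Y)" "\<And>t x. t \<in> {0..1} \<Longrightarrow> g t (f t x) = x"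
  shows "path_act n g (path_act n f \<gamma>) = \<gamma>"
proof
  fix t
  show "path_act n g (path_act n f \<gamma>) t = \<gamma> t"
  proof (cases "t \<in> {0..1}")
    case True
    then have "\<gamma> t \<in> topspace (config_space euclidean n)"
      using assms(1) unfolding topspace_E_space by (auto simp: continuous_map_def)
    then have "config_act n (g t) (config_act n (f t) (\<gamma> t)) = \<gamma> t"
      using assms(2)[OF True] by (rule config_act_inverse)
    then show ?thesis
      using True by (simp add: path_act_def)
  next
    case False
    then show ?thesis
      using assms(1) by (simp add: path_act_def topspace_E_space extensional_def restrict_def del: atLeastAtMost_iff)
  qed
qed

lemma continuous_map_config_act:
  assumes \<phi>: "homeo_family P \<phi> \<psi>" and p: "continuous_map T P p"
    and A: "continuous_map T (config_space euclidean n) A"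
  shows "continuous_map T (config_space euclidean n) (\<lambda>s. config_act n (\<phi> (p s)) (A s))"
  unfolding continuous_map_into_config_space
proof (intro conjI ballI)
  show "(\<lambda>s. config_act n (\<phi> (p s)) (A s)) \<in> topspace T \<rightarrow> extensional {1..n}"
    by (auto simp: config_act_def)
next
  fix s assume s: "s \<in> topspace T"
  then have "p s \<in> topspace P"
    using p continuous_map_image_subset_topspace by blast
  then have "inj (\<phi> (p s))"
    by (rule homeo_family_inj[OF \<phi>])
  moreover have "inj_on (A s) {1..n}"
    using A s unfolding continuous_map_into_config_space by blast
  ultimately have "inj_on (\<phi> (p s) \<circ> A s) {1..n}"
    by (meson comp_inj_on inj_on_subset subset_UNIV)
  moreover have "inj_on (config_act n (\<phi> (p s)) (A s)) {1..n} \<longleftrightarrow> inj_on (\<phi> (p s) \<circ> A s) {1..n}"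
    by (rule inj_on_cong) (simp add: config_act_def)
  ultimately show "inj_on (config_act n (\<phi> (p s)) (A s)) {1..n}"
    by simp
next
  fix i assume i: "i \<in> {1..n}"
  then have "continuous_map T euclidean (\<lambda>s. A s i)"
    using A unfolding continuous_map_into_config_space by blast
  then show "continuous_map T euclidean (\<lambda>s. config_act n (\<phi> (p s)) (A s) i)"
    using i homeo_family_continuous[OF \<phi> p] by (simp add: config_act_def)
qed

lemma config_avoids_act:
  assumes "config_avoids n m A c" "inj f" "\<And>j. j \<in> {1..m} \<Longrightarrow> f (c j) = d j"
  shows "config_avoids n m (config_act n f A) d"
  using assms unfolding config_avoids_def config_act_def inj_def by (metis restrict_apply')

text \<open>Uncurrying turns the claim into continuity of a map of parameter, path and time, which
  follows from the evaluation of paths and the joint continuity of \<open>\<phi>\<close>. The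
  parameter \<open>p\<close> is kept because the local charts of the fibration vary the isotopy with
  the base point.\<close>

lemma continuous_map_path_act:
  assumes \<phi>: "homeo_family (prod_topology P unit_interval) \<phi> \<psi>"
    and Y: "\<And>p t j. p \<in> topspace P \<Longrightarrow> t \<in> {0..1} \<Longrightarrow> j \<in> {1..m} \<Longrightarrow> \<phi> (p, t) (Y t j) = Y' t j"
  shows "continuous_map (prod_topology P (E_space n m Y)) (E_space n m Y')
    (\<lambda>(p, \<gamma>). path_act n (\<lambda>t. \<phi> (p, t)) \<gamma>)"
proof -
  let ?T = "prod_topology (prod_topology P (E_space n m Y)) unit_interval"
  have fst: "continuous_map ?T (prod_topology P unit_interval) (\<lambda>z. (fst (fst z), snd z))"
    by (intro continuous_intros continuous_map_compose[OF continuous_map_fst continuous_map_fst, unfolded o_def])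
  have "continuous_map ?T (prod_topology (E_space n m Y) unit_interval) (\<lambda>z. (snd (fst z), snd z))"
    by (intro continuous_intros continuous_map_compose[OF continuous_map_fst continuous_map_snd, unfolded o_def])
  from continuous_map_compose[OF this continuous_map_E_space_apply]
  have "continuous_map ?T (config_space euclidean n) (\<lambda>z. snd (fst z) (snd z))"
    by (simp add: o_def)
  from continuous_map_config_act[OF \<phi> fst this]
  have "continuous_map (prod_topology P (E_space n m Y)) (E_space n m Y')
      (\<lambda>z. restrict (\<lambda>t. config_act n (\<phi> (fst z, t)) (snd z t)) {0..1})"
  proof (intro continuous_map_into_E_space, simp only: case_prod_unfold)
    fix z t assume z: "z \<in> topspace (prod_topology P (E_space n m Y))" and t: "t \<in> {0..1::real}"
    then have mem: "(fst z, t) \<in> topspace (prod_topology P unit_interval)"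
      by auto
    show "config_avoids n m (config_act n (\<phi> (fst z, t)) (snd z t)) (Y' t)"
    proof (rule config_avoids_act)
      show "config_avoids n m (snd z t) (Y t)"
        using z t by (auto simp: topspace_E_space)
      show "inj (\<phi> (fst z, t))"
        by (rule homeo_family_inj[OF \<phi> mem])
      show "\<phi> (fst z, t) (Y t j) = Y' t j" if "j \<in> {1..m}" for j
        using Y z t that by auto
    qed
  qed
  then show ?thesis
    by (simp add: path_act_def case_prod_unfold)
qed

lemma continuous_map_path_act_fixed:
  assumes \<phi>: "homeo_family unit_interval \<phi> \<psi>"
    and Y: "\<And>t j. t \<in> {0..1} \<Longrightarrow> j \<in> {1..m} \<Longrightarrow> \<phi> t (Y t j) = Y' t j"
  shows "continuous_map (E_space n m Y) (E_space n m Y') (path_act n \<phi>)"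
proof -
  \<comment> \<open>A single isotopy is a family over the one-point parameter space.\<close>
  have "homeo_family (prod_topology (discrete_topology {()}) unit_interval) (\<lambda>z. \<phi> (snd z)) (\<lambda>z. \<psi> (snd z))"
    by (rule homeo_family_pullback[OF continuous_map_snd \<phi>])
  then have "continuous_map (prod_topology (discrete_topology {()}) (E_space n m Y)) (E_space n m Y')
      (\<lambda>(p, \<gamma>). path_act n (\<lambda>t. \<phi> (snd (p, t))) \<gamma>)"
    by (rule continuous_map_path_act) (use Y in simp)
  moreover have "continuous_map (E_space n m Y) (prod_topology (discrete_topology {()}) (E_space n m Y)) (\<lambda>\<gamma>. ((), \<gamma>))"
    by (simp add: continuous_map_paired continuous_map_id[unfolded id_def])
  ultimately have "continuous_map (E_space n m Y) (E_space n m Y')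
      ((\<lambda>(p, \<gamma>). path_act n (\<lambda>t. \<phi> (snd (p, t))) \<gamma>) \<circ> (\<lambda>\<gamma>. ((), \<gamma>)))"
    by (intro continuous_map_compose)
  then show ?thesis
    by (simp add: o_def)
qed

lemma continuous_map_config_act_B_space:
  assumes \<phi>: "homeo_family unit_interval \<phi> \<psi>"
    and Y: "\<And>t j. t \<in> {0..1} \<Longrightarrow> j \<in> {1..m} \<Longrightarrow> \<phi> t (Y t j) = Y' t j"
  shows "continuous_map (B_space n m Y) (B_space n m Y')
    (\<lambda>z. (config_act n (\<phi> 0) (fst z), config_act n (\<phi> 1) (snd z)))"
proof -
  have "continuous_map (B_space n m Y) (config_space euclidean n) fst"
    "continuous_map (B_space n m Y) (config_space euclidean n) snd"
    unfolding B_space_def by (intro continuous_intros)+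
  then have "continuous_map (B_space n m Y) (prod_topology (config_space euclidean n) (config_space euclidean n))
      (\<lambda>z. (config_act n (\<phi> 0) (fst z), config_act n (\<phi> 1) (snd z)))"
    by (intro continuous_map_pairedI continuous_map_config_act[OF \<phi>]) auto
  moreover have inj: "inj (\<phi> t)" if "t \<in> {0..1}" for t
    using homeo_family_inj[OF \<phi>, of t] that by simp
  have "config_avoids n m (config_act n (\<phi> 0) (fst z)) (Y' 0) \<and> config_avoids n m (config_act n (\<phi> 1) (snd z)) (Y' 1)"
    if "z \<in> topspace (B_space n m Y)" for z
    using that by (cases z) (auto simp: topspace_B_space intro!: config_avoids_act inj Y)
  ultimately show ?thesis
    by (auto simp: B_space_def[of n m Y'] continuous_map_in_subtopology)
qed

text \<open>Endpoints see the isotopy only at times 0 and 1, so the map of the bases acts by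
  \<open>\<phi> 0\<close> on the first configuration and by \<open>\<phi> 1\<close> on the
  second.\<close>

lemma fibrewise_homeomorphic_E_space:
  assumes \<phi>: "homeo_family unit_interval \<phi> \<psi>"
    and Y: "\<And>t j. t \<in> {0..1} \<Longrightarrow> j \<in> {1..m} \<Longrightarrow> \<phi> t (Y t j) = Y' t j"
  shows "fibrewise_homeomorphic (E_space n m Y) (B_space n m Y) endpoints (E_space n m Y') (B_space n m Y') endpoints"
proof (rule fibrewise_homeomorphicI)
  note \<psi> = homeo_family_inverse[OF \<phi>]
  have inv: "\<psi> t (\<phi> t x) = x" "\<phi> t (\<psi> t x) = x" if "t \<in> {0..1}" for t x
    using that homeo_family_left_inverse[OF \<phi>] homeo_family_right_inverse[OF \<phi>] by auto
  have Y': "\<psi> t (Y' t j) = Y t j" if "t \<in> {0..1}" "j \<in> {1..m}" for t j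
    using inv(1)[OF that(1), of "Y t j"] Y[OF that] by simp
  show "homeomorphic_maps (E_space n m Y) (E_space n m Y') (path_act n \<phi>) (path_act n \<psi>)"
    unfolding homeomorphic_maps_def
    using continuous_map_path_act_fixed[of \<phi> \<psi> m Y Y' n, OF \<phi> Y] continuous_map_path_act_fixed[of \<psi> \<phi> m Y' Y n, OF \<psi> Y']
      path_act_inverse[of _ n m Y \<psi> \<phi>] path_act_inverse[of _ n m Y' \<phi> \<psi>] inv by blast
  have act: "config_act n (\<psi> t) (config_act n (\<phi> t) A) = A" "config_act n (\<phi> t) (config_act n (\<psi> t) A) = A"
    if "A \<in> topspace (config_space euclidean n)" "t \<in> {0..1}" for A t
    using that inv by (auto intro: config_act_inverse)
  show "homeomorphic_maps (B_space n m Y) (B_space n m Y')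
      (\<lambda>z. (config_act n (\<phi> 0) (fst z), config_act n (\<phi> 1) (snd z)))
      (\<lambda>z. (config_act n (\<psi> 0) (fst z), config_act n (\<psi> 1) (snd z)))"
    unfolding homeomorphic_maps_def
  proof (intro conjI ballI)
    fix z assume "z \<in> topspace (B_space n m Y)"
    then show "(config_act n (\<psi> 0) (fst (config_act n (\<phi> 0) (fst z), config_act n (\<phi> 1) (snd z))),
          config_act n (\<psi> 1) (snd (config_act n (\<phi> 0) (fst z), config_act n (\<phi> 1) (snd z)))) = z"
      by (cases z) (simp add: topspace_B_space act)
  next
    fix z assume "z \<in> topspace (B_space n m Y')"
    then show "(config_act n (\<phi> 0) (fst (config_act n (\<psi> 0) (fst z), config_act n (\<psi> 1) (snd z))),
          config_act n (\<phi> 1) (snd (config_act n (\<psi> 0) (fst z), config_act n (\<psi> 1) (snd z)))) = z"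
      by (cases z) (simp add: topspace_B_space act)
  qed (intro continuous_map_config_act_B_space[OF \<phi> Y] continuous_map_config_act_B_space[OF \<psi> Y'], assumption+)+
  show "endpoints (path_act n \<phi> \<gamma>) =
      (config_act n (\<phi> 0) (fst (endpoints \<gamma>)), config_act n (\<phi> 1) (snd (endpoints \<gamma>)))" for \<gamma>
    by (simp add: endpoints_path_act) (simp add: endpoints_def)
qed

section \<open>Making the obstacles stationary\<close>

lemma obstacle_trajectoryD:
  fixes Y :: "real \<Rightarrow> nat \<Rightarrow> 'a::topological_space"
  assumes "obstacle_trajectory m Y"
  shows "j \<in> {1..m} \<Longrightarrow> continuous_on {0..1} (\<lambda>t. Y t j)" "t \<in> {0..1} \<Longrightarrow> inj_on (Y t) {1..m}"
  using assms unfolding obstacle_trajectory_def continuous_map_into_config_space by auto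

text \<open>The straightening brings the obstacles to rest at positions \<open>k\<close> that cannot
  be chosen. A second homeomorphism, independent of time, then carries \<open>k\<close> to
  \<open>c\<close>; its existence rests on the dimension being at least 2.\<close>

lemma fibrewise_homeomorphic_constant:
  fixes Y :: "real \<Rightarrow> nat \<Rightarrow> 'a::euclidean_space" and c :: "nat \<Rightarrow> 'a"
  assumes dim: "2 \<le> DIM('a)" and Y: "obstacle_trajectory m Y" and c: "c \<in> topspace (config_space euclidean m)"
  shows "fibrewise_homeomorphic (E_space n m Y) (B_space n m Y) endpoints
    (E_space n m (\<lambda>t. c)) (B_space n m (\<lambda>t. c)) endpoints"
proof -
  have "\<exists>\<phi> \<psi> k. homeo_family unit_interval \<phi> \<psi> \<and> (\<forall>t\<in>{0..1}. \<forall>j\<in>{1..m}. \<phi> t (Y t j) = k j)"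
    using obstacle_trajectoryD[OF Y] by (intro straighten_trajectory) auto
  then obtain \<phi> \<psi> k where \<phi>: "homeo_family unit_interval \<phi> \<psi>"
    and k: "\<forall>t\<in>{0..1}. \<forall>j\<in>{1..m}. \<phi> t (Y t j) = k j"
    by (elim exE conjE)
  have kY: "k j = \<phi> 0 (Y 0 j)" if "j \<in> {1..m}" for j
    using k that by simp
  have "inj_on k {1..m}"
  proof -
    have "inj (\<phi> 0)"
      by (rule homeo_family_inj[OF \<phi>]) simp
    then have "inj_on (\<phi> 0 \<circ> Y 0) {1..m}"
      using obstacle_trajectoryD(2)[OF Y, of 0] by (auto intro: comp_inj_on inj_on_subset)
    moreover have "(\<phi> 0 \<circ> Y 0) j = k j" if "j \<in> {1..m}" for j
      using kY[OF that] by simp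
    ultimately show ?thesis
      using inj_on_cong by blast
  qed
  moreover have "inj_on c {1..m}"
    using c by (simp add: topspace_config_space)
  ultimately have pw: "pairwise (\<lambda>i j. k i \<noteq> k j \<and> c i \<noteq> c j) {1..m}"
    unfolding pairwise_def inj_on_def by blast
  obtain f g where f: "homeomorphism UNIV UNIV f g" "\<And>j. j \<in> {1..m} \<Longrightarrow> f (k j) = c j"
    by (rule homeomorphism_moving_points_exists[OF dim open_UNIV connected_UNIV, of UNIV "{1..m}" k c])
      (use pw in auto)
  have "homeo_family unit_interval (\<lambda>t x. f (\<phi> t x)) (\<lambda>t x. \<psi> t (g x))"
    by (rule homeo_family_compose[OF homeo_family_const[OF f(1)] \<phi>])
  then show ?thesis
    by (rule fibrewise_homeomorphic_E_space) (use k f(2) in auto)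
qed


section \<open>Connectedness of configuration spaces\<close>

text \<open>A single point moves while the others stand still. Its room \<open>D\<close> is the
  space minus finitely many points, connected in dimension at least 2, and the configurations
  obtained from all positions in \<open>D\<close> form a connected set containing both
  \<open>A\<close> and the update.\<close>

lemma connected_component_of_config_update:
  fixes S :: "'a::euclidean_space set"
  assumes dim: "2 \<le> DIM('a)" and "finite S" and i: "i \<in> {1..n}"
    and A: "A \<in> topspace (config_space (top_of_set (UNIV - S)) n)"
    and z: "z \<notin> S" "z \<notin> A ` ({1..n} - {i})"
  shows "connected_component_of (config_space (top_of_set (UNIV - S)) n) A (A(i := z))"
proof -
  let ?X = "config_space (top_of_set (UNIV - S)) n"
  define D where "D = UNIV - (S \<union> A ` ({1..n} - {i}))"
  have "connected D"
    unfolding D_def by (intro connected_open_delete_finite) (use dim \<open>finite S\<close> in auto)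
  have A': "A \<in> extensional {1..n}" "\<And>j. j \<in> {1..n} \<Longrightarrow> A j \<notin> S" "inj_on A {1..n}"
    using A by (auto simp: topspace_config_space PiE_def Pi_def)
  have upd: "continuous_map (top_of_set D) ?X (\<lambda>w. A(i := w))"
    unfolding continuous_map_into_config_space
  proof (intro conjI ballI)
    show "(\<lambda>w. A(i := w)) \<in> topspace (top_of_set D) \<rightarrow> extensional {1..n}"
      using A'(1) i by (auto simp: extensional_def)
  next
    fix w assume "w \<in> topspace (top_of_set D)"
    then have w: "w \<noteq> A a" if "a \<in> {1..n}" "a \<noteq> i" for a
      using that by (auto simp: D_def)
    show "inj_on (A(i := w)) {1..n}"
    proof (rule inj_onI)
      fix a b assume ab: "a \<in> {1..n}" "b \<in> {1..n}" "(A(i := w)) a = (A(i := w)) b"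
      then show "a = b"
        using w[OF ab(1)] w[OF ab(2)] inj_onD[OF A'(3) _ ab(1,2)] by (cases "a = i"; cases "b = i") auto
    qed
  next
    fix j assume "j \<in> {1..n}"
    then show "continuous_map (top_of_set D) (top_of_set (UNIV - S)) (\<lambda>w. (A(i := w)) j)"
      using A'(2) by (cases "j = i") (auto simp: D_def continuous_map_in_subtopology)
  qed
  have "connectedin (top_of_set D) D"
    using \<open>connected D\<close> by (simp add: connectedin_subtopology)
  then have "connectedin ?X ((\<lambda>w. A(i := w)) ` D)"
    using upd connectedin_continuous_map_image by blast
  moreover have "A i \<in> D" "z \<in> D"
    using A'(2)[OF i] z i inj_onD[OF A'(3)] by (auto simp: D_def)
  then have "A \<in> (\<lambda>w. A(i := w)) ` D" "A(i := z) \<in> (\<lambda>w. A(i := w)) ` D"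
    by (auto intro: image_eqI[of _ _ "A i"])
  ultimately show ?thesis
    unfolding connected_component_of_def by blast
qed

lemma connected_component_of_config_disjoint:
  fixes S :: "'a::euclidean_space set"
  assumes dim: "2 \<le> DIM('a)" and S: "finite S"
    and A: "A \<in> topspace (config_space (top_of_set (UNIV - S)) n)"
    and C: "C \<in> topspace (config_space (top_of_set (UNIV - S)) n)"
    and disj: "A ` {1..n} \<inter> C ` {1..n} = {}"
  shows "connected_component_of (config_space (top_of_set (UNIV - S)) n) A C"
proof -
  let ?X = "config_space (top_of_set (UNIV - S)) n"
  \<comment> \<open>After \<open>k\<close> moves the first \<open>k\<close> points sit at
    \<open>C\<close> and the rest still at \<open>A\<close>. Disjointness of the two configurations
    ensures that the next target is never occupied by a point yet to move.\<close>
  define M where "M k = (\<lambda>i. if i \<in> {1..k} then C i else A i)" for k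
  have "connected_component_of ?X A (M k)" if "k \<le> n" for k
    using that
  proof (induction k)
    case 0
    have "M 0 = A"
      by (simp add: M_def)
    then show ?case
      using A connected_component_of_refl by metis
  next
    case (Suc k)
    then have IH: "connected_component_of ?X A (M k)"
      by simp
    then have Mk: "M k \<in> topspace ?X"
      by (rule connected_component_in_topspace[THEN conjunct2])
    have k: "Suc k \<in> {1..n}"
      using Suc.prems by simp
    have Ck: "C (Suc k) \<notin> S" "inj_on C {1..n}"
      using C k by (auto simp: topspace_config_space PiE_def Pi_def)
    have "C (Suc k) \<noteq> M k i" if i: "i \<in> {1..n} - {Suc k}" for i
    proof (cases "i \<in> {1..k}")
      case True
      then show ?thesis
        using k i inj_onD[OF Ck(2), of "Suc k" i] by (auto simp: M_def)
    next
      case False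
      then have "M k i = A i"
        by (simp only: M_def if_False)
      moreover have "A i \<in> A ` {1..n}" "C (Suc k) \<in> C ` {1..n}"
        using k i by blast+
      ultimately show ?thesis
        using disj by (metis disjoint_iff)
    qed
    then have "C (Suc k) \<notin> M k ` ({1..n} - {Suc k})"
      by blast
    then have "connected_component_of ?X (M k) ((M k)(Suc k := C (Suc k)))"
      using Ck(1) by (intro connected_component_of_config_update[OF dim S k Mk])
    moreover have "(M k)(Suc k := C (Suc k)) = M (Suc k)"
      by (auto simp: M_def fun_eq_iff)
    ultimately show ?case
      using IH connected_component_of_trans by fastforce
  qed
  moreover have "M n = C"
    using A C by (auto simp: M_def fun_eq_iff topspace_config_space PiE_def extensional_def)
  ultimately show ?thesis
    by (metis order_refl)
qed

lemma connected_space_config: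
  fixes S :: "'a::euclidean_space set"
  assumes dim: "2 \<le> DIM('a)" and S: "finite S"
  shows "connected_space (config_space (top_of_set (UNIV - S)) n)"
  unfolding connected_space_iff_connected_component
proof (intro ballI)
  let ?X = "config_space (top_of_set (UNIV - S)) n"
  fix A B assume A: "A \<in> topspace ?X" and B: "B \<in> topspace ?X"
  let ?T = "S \<union> A ` {1..n} \<union> B ` {1..n}"
  \<comment> \<open>Two arbitrary configurations may share points, so both are joined to a third
    one, \<open>C\<close>, that is disjoint from each; infinitely many free points leave room for
    it.\<close>
  have "infinite (UNIV - ?T)"
    using S finite_imp_bounded[of "UNIV :: 'a set"] by (intro Diff_infinite_finite) auto
  then obtain Q where Q: "Q \<subseteq> UNIV - ?T" "finite Q" "card Q = n"
    using infinite_arbitrarily_large[OF \<open>infinite _\<close>, of n] by (elim exE conjE)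
  then obtain f where f: "bij_betw f {1..n} Q"
    using finite_same_card_bij[of "{1..n}" Q] by auto
  define C where "C = restrict f {1..n}"
  have "C ` {1..n} = Q" "inj_on C {1..n}"
    using f by (auto simp: C_def bij_betw_def)
  then have C: "C \<in> topspace ?X" "A ` {1..n} \<inter> C ` {1..n} = {}" "B ` {1..n} \<inter> C ` {1..n} = {}"
    using Q by (auto simp: topspace_config_space C_def)
  have "connected_component_of ?X A C" "connected_component_of ?X B C"
    using connected_component_of_config_disjoint[OF dim S _ C(1)] A B C(2,3) by auto
  then show "connected_component_of ?X A B"
    using connected_component_of_trans connected_component_of_sym by fast
qed

section \<open>Stationary obstacles and the path fibration of the complement\<close>

lemma config_space_avoiding:
  "subtopology (config_space euclidean n) {A. config_avoids n m A c} =
     config_space (top_of_set (UNIV - c ` {1..m})) n"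
  unfolding config_space_subtopology
  by (rule arg_cong[where f="subtopology _"]) (auto simp: config_avoids_def)

lemma B_space_const:
  "B_space n m (\<lambda>t. c) = prod_topology (config_space (top_of_set (UNIV - c ` {1..m})) n)
     (config_space (top_of_set (UNIV - c ` {1..m})) n)"
proof -
  have "{(A, B). config_avoids n m A c \<and> config_avoids n m B c} =
      {A. config_avoids n m A c} \<times> {A. config_avoids n m A c}"
    by auto
  then show ?thesis
    unfolding B_space_def by (simp add: subtopology_Times config_space_avoiding)
qed

text \<open>A constant obstacle set imposes the same condition at every time, so an avoiding path is
  a path in one fixed subspace. Together with the description of the base this makes the Schwarz
  genus literally a value of \<open>TC\<close>.\<close>

lemma E_space_const:
  "E_space n m (\<lambda>t. c) = path_space (config_space (top_of_set (UNIV - c ` {1..m})) n)"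
  unfolding E_space_def path_space_def config_space_avoiding[symmetric]
  by (subst compact_open_subtopology) (simp_all add: locally_compact_unit_interval)

section \<open>Local triviality for stationary obstacles\<close>

text \<open>Over a neighbourhood of \<open>(A\<^sub>0, B\<^sub>0)\<close> the fibre over \<open>(A\<^sub>0, B\<^sub>0)\<close> is carried along by an ambient
  isotopy that fixes the obstacles, moves \<open>A\<^sub>0\<close> to \<open>A\<close> at time 0 and \<open>B\<^sub>0\<close> to \<open>B\<close> at time 1.\<close>

lemma local_isotopy:
  fixes c :: "nat \<Rightarrow> 'a::euclidean_space"
  assumes b: "(A\<^sub>0, B\<^sub>0) \<in> topspace (B_space n m (\<lambda>t. c))" (is "_ \<in> topspace ?B")
  shows "\<exists>U \<phi> \<psi>. openin ?B U \<and> (A\<^sub>0, B\<^sub>0) \<in> U \<and>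
    homeo_family (prod_topology (subtopology ?B U) unit_interval) \<phi> \<psi> \<and>
    (\<forall>u\<in>U. \<forall>t\<in>{0..1}. \<forall>j\<in>{1..m}. \<phi> (u, t) (c j) = c j) \<and>
    (\<forall>u\<in>U. (config_act n (\<phi> (u, 0)) A\<^sub>0, config_act n (\<phi> (u, 1)) B\<^sub>0) = u)"
proof -
  have A\<^sub>0: "A\<^sub>0 \<in> extensional {1..n}" "inj_on A\<^sub>0 {1..n}" "\<And>i j. i \<in> {1..n} \<Longrightarrow> j \<in> {1..m} \<Longrightarrow> c j \<noteq> A\<^sub>0 i"
    and B\<^sub>0: "B\<^sub>0 \<in> extensional {1..n}" "inj_on B\<^sub>0 {1..n}" "\<And>i j. i \<in> {1..n} \<Longrightarrow> j \<in> {1..m} \<Longrightarrow> c j \<noteq> B\<^sub>0 i"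
    using b config_spaceD unfolding topspace_B_space config_avoids_def by metis+
  \<comment> \<open>One radius serves both pushes and keeps the obstacles outside all their bumps. A
    point common to \<open>A\<^sub>0\<close> and \<open>B\<^sub>0\<close> does no harm, since only
    one of the two pushes is active at each end of the time interval.\<close>
  let ?S = "A\<^sub>0 ` {1..n} \<union> B\<^sub>0 ` {1..n} \<union> c ` {1..m}"
  have "finite ?S"
    by simp
  from finite_set_separated[OF this]
  obtain \<rho> where \<rho>: "\<rho> > 0" and sep: "\<forall>x\<in>?S. \<forall>y\<in>?S. x \<noteq> y \<longrightarrow> \<rho> \<le> dist x y"
    by (elim exE conjE)
  have sepA: "\<rho> \<le> dist (A\<^sub>0 i) (A\<^sub>0 j)" if "i \<in> {1..n}" "j \<in> {1..n}" "j \<noteq> i" for i j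
    using sep inj_onD[OF A\<^sub>0(2), of i j] that by blast
  have sepB: "\<rho> \<le> dist (B\<^sub>0 i) (B\<^sub>0 j)" if "i \<in> {1..n}" "j \<in> {1..n}" "j \<noteq> i" for i j
    using sep inj_onD[OF B\<^sub>0(2), of i j] that by blast
  have sepAc: "\<rho> \<le> dist (c j) (A\<^sub>0 i)" if "i \<in> {1..n}" "j \<in> {1..m}" for i j
    using sep A\<^sub>0(3)[OF that] that by blast
  have sepBc: "\<rho> \<le> dist (c j) (B\<^sub>0 i)" if "i \<in> {1..n}" "j \<in> {1..m}" for i j
    using sep B\<^sub>0(3)[OF that] that by blast
  define dA where "dA z = (\<Sum>i\<in>{1..n}. norm (fst z i - A\<^sub>0 i))" for z :: "(nat \<Rightarrow> 'a) \<times> (nat \<Rightarrow> 'a)"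
  define dB where "dB z = (\<Sum>i\<in>{1..n}. norm (snd z i - B\<^sub>0 i))" for z :: "(nat \<Rightarrow> 'a) \<times> (nat \<Rightarrow> 'a)"
  \<comment> \<open>Total displacements below \<rho>/2 are those for which the pushes are
    invertible.\<close>
  define U where "U = {z \<in> topspace ?B. dA z \<in> {..<\<rho> / 2}} \<inter> {z \<in> topspace ?B. dB z \<in> {..<\<rho> / 2}}"
  have "continuous_map ?B (config_space euclidean n) fst" "continuous_map ?B (config_space euclidean n) snd"
    unfolding B_space_def by (intro continuous_intros)+
  then have nth: "continuous_map ?B euclidean (\<lambda>z. fst z i)" "continuous_map ?B euclidean (\<lambda>z. snd z i)"
    if "i \<in> {1..n}" for i
    using that by (auto simp: continuous_map_into_config_space)
  have "continuous_map ?B euclidean dA" "continuous_map ?B euclidean dB"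
    unfolding dA_def[abs_def] dB_def[abs_def] by (intro continuous_intros nth finite_atLeastAtMost; assumption)+
  then have U: "openin ?B U"
    unfolding U_def by (intro openin_Int openin_continuous_map_preimage) auto
  have bU: "(A\<^sub>0, B\<^sub>0) \<in> U"
    using b \<rho> by (simp add: U_def dA_def dB_def)
  let ?P = "prod_topology (subtopology ?B U) unit_interval"
  have P: "fst p \<in> U" "snd p \<in> {0..1}" if "p \<in> topspace ?P" for p
    using that by auto
  have proj: "continuous_map ?P ?B fst" "continuous_map ?P euclideanreal snd"
    using continuous_map_fst[of "subtopology ?B U" unit_interval] continuous_map_snd[of "subtopology ?B U" unit_interval]
    by (auto simp: continuous_map_in_subtopology)
  \<comment> \<open>The weights \<open>1 - snd p\<close> and \<open>snd p\<close> switch off the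
    push at \<open>B\<^sub>0\<close> at time 0 and the push at \<open>A\<^sub>0\<close> at time 1.
    Lying between 0 and 1, they preserve the bound \<rho>/2 at all times.\<close>
  define v where "v p = (\<lambda>i. (1 - snd p) *\<^sub>R (fst (fst p) i - A\<^sub>0 i))" for p :: "((nat \<Rightarrow> 'a) \<times> (nat \<Rightarrow> 'a)) \<times> real"
  define w where "w p = (\<lambda>i. snd p *\<^sub>R (snd (fst p) i - B\<^sub>0 i))" for p :: "((nat \<Rightarrow> 'a) \<times> (nat \<Rightarrow> 'a)) \<times> real"
  have scaleR: "continuous_map ?P euclidean (\<lambda>p. f p *\<^sub>R g p)"
    if "continuous_map ?P euclideanreal f" "continuous_map ?P euclidean g" for f and g :: "_ \<Rightarrow> 'a"
    using that unfolding continuous_map_atin limitin_canonical_iff by (auto intro!: tendsto_scaleR)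
  have nthP: "continuous_map ?P euclidean (\<lambda>p. fst (fst p) i)" "continuous_map ?P euclidean (\<lambda>p. snd (fst p) i)"
    if "i \<in> {1..n}" for i
    using nth[OF that, THEN continuous_map_compose[OF proj(1)]] by (simp_all add: o_def)
  have v: "continuous_map ?P euclidean (\<lambda>p. v p i)" and w: "continuous_map ?P euclidean (\<lambda>p. w p i)"
    if "i \<in> {1..n}" for i
    unfolding v_def w_def by (intro scaleR continuous_map_diff nthP[OF that] proj(2) continuous_map_canonical_const)+
  have scale_le: "(\<Sum>i\<in>{1..n}. norm (s *\<^sub>R f i)) \<le> (\<Sum>i\<in>{1..n}. norm (f i))"
    if "0 \<le> s" "s \<le> 1" for s and f :: "nat \<Rightarrow> 'a"
    using that by (intro sum_mono) (simp add: mult_left_le_one_le)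
  have small_v: "(\<Sum>i\<in>{1..n}. norm (v p i)) \<le> \<rho> / 2" if "p \<in> topspace ?P" for p
    unfolding v_def using P[OF that] scale_le[of "1 - snd p" "\<lambda>i. fst (fst p) i - A\<^sub>0 i"]
    by (simp add: U_def dA_def)
  have small_w: "(\<Sum>i\<in>{1..n}. norm (w p i)) \<le> \<rho> / 2" if "p \<in> topspace ?P" for p
    unfolding w_def using P[OF that] scale_le[of "snd p" "\<lambda>i. snd (fst p) i - B\<^sub>0 i"]
    by (simp add: U_def dB_def)
  obtain \<psi>1 where \<psi>1: "homeo_family ?P (\<lambda>p. bump_push {1..n} \<rho> A\<^sub>0 (v p)) \<psi>1"
    using homeo_family_bump_push[of "{1..n}" \<rho> ?P v A\<^sub>0, OF finite_atLeastAtMost \<rho>] v small_v by blast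
  obtain \<psi>2 where \<psi>2: "homeo_family ?P (\<lambda>p. bump_push {1..n} \<rho> B\<^sub>0 (w p)) \<psi>2"
    using homeo_family_bump_push[of "{1..n}" \<rho> ?P w B\<^sub>0, OF finite_atLeastAtMost \<rho>] w small_w by blast
  let ?\<phi> = "\<lambda>p x. bump_push {1..n} \<rho> A\<^sub>0 (v p) (bump_push {1..n} \<rho> B\<^sub>0 (w p) x)"
  have "homeo_family ?P ?\<phi> (\<lambda>p x. \<psi>2 p (\<psi>1 p x))"
    by (rule homeo_family_compose[OF \<psi>1 \<psi>2])
  moreover have "?\<phi> (u, t) (c j) = c j" if "j \<in> {1..m}" for u t j
  proof -
    have "bump_push {1..n} \<rho> B\<^sub>0 (w (u, t)) (c j) = c j" "bump_push {1..n} \<rho> A\<^sub>0 (v (u, t)) (c j) = c j"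
      by (intro bump_push_outside[OF \<rho>] sepBc sepAc that; assumption)+
    then show ?thesis
      by simp
  qed
  moreover have "(config_act n (?\<phi> (u, 0)) A\<^sub>0, config_act n (?\<phi> (u, 1)) B\<^sub>0) = u" if u: "u \<in> U" for u
  proof -
    have ext: "fst u \<in> extensional {1..n}" "snd u \<in> extensional {1..n}"
      using u by (auto simp: U_def B_space_def dest: config_spaceD)
    have "?\<phi> (u, 0) (A\<^sub>0 i) = fst u i" if i: "i \<in> {1..n}" for i
    proof -
      have "bump_push {1..n} \<rho> B\<^sub>0 (w (u, 0)) (A\<^sub>0 i) = A\<^sub>0 i"
        by (rule bump_push_zero) (simp add: w_def)
      moreover have "bump_push {1..n} \<rho> A\<^sub>0 (v (u, 0)) (A\<^sub>0 i) = A\<^sub>0 i + v (u, 0) i"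
        by (rule bump_push_centre[OF finite_atLeastAtMost \<rho> i]) (rule sepA[OF i])
      ultimately show ?thesis
        by (simp add: v_def)
    qed
    moreover have "?\<phi> (u, 1) (B\<^sub>0 i) = snd u i" if i: "i \<in> {1..n}" for i
    proof -
      have "bump_push {1..n} \<rho> B\<^sub>0 (w (u, 1)) (B\<^sub>0 i) = B\<^sub>0 i + w (u, 1) i"
        by (rule bump_push_centre[OF finite_atLeastAtMost \<rho> i]) (rule sepB[OF i])
      moreover have "bump_push {1..n} \<rho> A\<^sub>0 (v (u, 1)) x = x" for x
        by (rule bump_push_zero) (simp add: v_def)
      ultimately show ?thesis
        by (simp add: w_def)
    qed
    ultimately have "config_act n (?\<phi> (u, 0)) A\<^sub>0 = fst u" "config_act n (?\<phi> (u, 1)) B\<^sub>0 = snd u"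
      using ext unfolding config_act_def by (auto intro: extensionalityI[of _ "{1..n}"])
    then show ?thesis
      by simp
  qed
  ultimately show ?thesis
    using U bU by blast
qed

text \<open>The chart lets the isotopy with parameter \<open>u\<close> act on a path of the fibre
  over \<open>b\<close>. The inverse chart must recover \<open>u\<close> from the path alone; it is
  the pair of endpoints, after which the inverse isotopy with that parameter returns the path to the
  fibre.\<close>

lemma local_triviality_constant:
  fixes c :: "nat \<Rightarrow> 'a::euclidean_space"
  defines "E \<equiv> \<lambda>n m. E_space n m (\<lambda>t. c)" and "B \<equiv> \<lambda>n m. B_space n m (\<lambda>t. c)"
  assumes b: "b \<in> topspace (B n m)"
  shows "\<exists>U h. openin (B n m) U \<and> b \<in> U \<and>
    homeomorphic_map
      (prod_topology (subtopology (B n m) U) (subtopology (E n m) {\<gamma> \<in> topspace (E n m). endpoints \<gamma> = b}))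
      (subtopology (E n m) {\<gamma> \<in> topspace (E n m). endpoints \<gamma> \<in> U}) h \<and>
    (\<forall>u\<in>U. \<forall>\<gamma>\<in>topspace (E n m). endpoints \<gamma> = b \<longrightarrow> endpoints (h (u, \<gamma>)) = u)"
proof -
  let ?E = "E n m" and ?B = "B n m"
  obtain U \<phi> \<psi> where U: "openin ?B U" "b \<in> U"
    and \<phi>: "homeo_family (prod_topology (subtopology ?B U) unit_interval) \<phi> \<psi>"
    and fix_c: "\<forall>u\<in>U. \<forall>t\<in>{0..1}. \<forall>j\<in>{1..m}. \<phi> (u, t) (c j) = c j"
    and move: "\<forall>u\<in>U. (config_act n (\<phi> (u, 0)) (fst b), config_act n (\<phi> (u, 1)) (snd b)) = u"
    using local_isotopy[of "fst b" "snd b" n m c, unfolded prod.collapse, OF b[unfolded B_def]]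
    unfolding B_def by (elim exE conjE)
  have UB: "U \<subseteq> topspace ?B"
    using U(1) openin_subset by blast
  have inv: "\<psi> (u, t) (\<phi> (u, t) x) = x" "\<phi> (u, t) (\<psi> (u, t) x) = x" if "u \<in> U" "t \<in> {0..1}" for u t x
    using homeo_family_left_inverse[OF \<phi>, of "(u, t)"] homeo_family_right_inverse[OF \<phi>, of "(u, t)"] that UB by auto
  let ?F = "subtopology ?E {\<gamma> \<in> topspace ?E. endpoints \<gamma> = b}"
  let ?EU = "subtopology ?E {\<gamma> \<in> topspace ?E. endpoints \<gamma> \<in> U}"
  let ?h = "\<lambda>(u, \<gamma>). path_act n (\<lambda>t. \<phi> (u, t)) \<gamma>"
  let ?k = "\<lambda>(u, \<gamma>). path_act n (\<lambda>t. \<psi> (u, t)) \<gamma>"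
  have ch: "continuous_map (prod_topology (subtopology ?B U) ?E) ?E ?h"
    unfolding E_def by (rule continuous_map_path_act[OF \<phi>]) (use fix_c in auto)
  have ck: "continuous_map (prod_topology (subtopology ?B U) ?E) ?E ?k"
    unfolding E_def
  proof (rule continuous_map_path_act[OF homeo_family_inverse[OF \<phi>]])
    fix u t j assume "u \<in> topspace (subtopology ?B U)" "t \<in> {0..1::real}" "j \<in> {1..m}"
    then show "\<psi> (u, t) (c j) = c j"
      using fix_c inv(1)[of u t "c j"] by simp
  qed
  have h_mem: "?h (u, \<gamma>) \<in> topspace ?E" and k_mem: "?k (u, \<gamma>) \<in> topspace ?E"
    if "u \<in> U" "\<gamma> \<in> topspace ?E" for u \<gamma>
    using continuous_map_image_subset_topspace[OF ch] continuous_map_image_subset_topspace[OF ck] that UB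
    by (auto simp: image_subset_iff)
  have h_end: "endpoints (?h (u, \<gamma>)) = u" if "u \<in> U" "endpoints \<gamma> = b" for u \<gamma>
    using move that by (auto simp: endpoints_path_act) (simp add: endpoints_def)
  \<comment> \<open>With the endpoints of \<open>\<gamma>\<close> as parameter,
    \<open>\<phi>\<close> moves \<open>b\<close> to these endpoints by \<open>move\<close>, so
    \<open>\<psi>\<close> moves them back to \<open>b\<close>.\<close>
  have k_end: "endpoints (?k (endpoints \<gamma>, \<gamma>)) = b" if "endpoints \<gamma> \<in> U" for \<gamma>
  proof -
    let ?u = "endpoints \<gamma>"
    have "b \<in> topspace (B_space n m (\<lambda>t. c))"
      using b by (simp add: B_def)
    then have mem: "fst b \<in> topspace (config_space euclidean n)" "snd b \<in> topspace (config_space euclidean n)"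
      by (auto simp: B_space_def)
    have u: "config_act n (\<phi> (?u, 0)) (fst b) = \<gamma> 0" "config_act n (\<phi> (?u, 1)) (snd b) = \<gamma> 1"
      using move that unfolding endpoints_def by auto
    have "config_act n (\<psi> (?u, 0)) (\<gamma> 0) = fst b"
      unfolding u(1)[symmetric] by (rule config_act_inverse[OF mem(1)]) (use inv that in auto)
    moreover have "config_act n (\<psi> (?u, 1)) (\<gamma> 1) = snd b"
      unfolding u(2)[symmetric] by (rule config_act_inverse[OF mem(2)]) (use inv that in auto)
    ultimately show ?thesis
      by (simp add: endpoints_path_act)
  qed
  have kh: "?k (u, ?h (u, \<gamma>)) = \<gamma>" and hk: "?h (u, ?k (u, \<gamma>)) = \<gamma>" if "u \<in> U" "\<gamma> \<in> topspace ?E" for u \<gamma>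
    using path_act_inverse[of \<gamma> n m "\<lambda>t. c" "\<lambda>t. \<psi> (u, t)" "\<lambda>t. \<phi> (u, t)"]
      path_act_inverse[of \<gamma> n m "\<lambda>t. c" "\<lambda>t. \<phi> (u, t)" "\<lambda>t. \<psi> (u, t)"] inv[OF that(1)] that(2)
    unfolding E_def by auto
  have "continuous_map (prod_topology (subtopology ?B U) ?F) ?E ?h"
    by (subst prod_topology_subtopology(2)) (rule continuous_map_from_subtopology[OF ch])
  then have ch': "continuous_map (prod_topology (subtopology ?B U) ?F) ?EU ?h"
    using h_mem h_end UB by (auto simp: continuous_map_in_subtopology)
  have "continuous_map ?EU (prod_topology (subtopology ?B U) ?E) (\<lambda>\<gamma>. (endpoints \<gamma>, \<gamma>))"
    using continuous_map_endpoints[of n m "\<lambda>t. c"] unfolding E_def B_def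
    by (auto simp: continuous_map_paired continuous_map_in_subtopology intro: continuous_map_from_subtopology
        continuous_map_from_subtopology[OF continuous_map_id, unfolded id_def])
  from continuous_map_compose[OF this ck]
  have "continuous_map ?EU ?E (\<lambda>\<gamma>. ?k (endpoints \<gamma>, \<gamma>))"
    by (simp add: o_def)
  then have ck': "continuous_map ?EU ?F (\<lambda>\<gamma>. ?k (endpoints \<gamma>, \<gamma>))"
    using k_mem k_end by (auto simp: continuous_map_in_subtopology)
  have "continuous_map ?EU (subtopology ?B U) endpoints"
    using continuous_map_endpoints[of n m "\<lambda>t. c"] unfolding E_def B_def
    by (auto simp: continuous_map_in_subtopology intro: continuous_map_from_subtopology)
  then have "homeomorphic_maps (prod_topology (subtopology ?B U) ?F) ?EU ?h (\<lambda>\<gamma>. (endpoints \<gamma>, ?k (endpoints \<gamma>, \<gamma>)))"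
    unfolding homeomorphic_maps_def using ch' ck'
  proof (intro conjI ballI)
    fix z assume "z \<in> topspace (prod_topology (subtopology ?B U) ?F)"
    then obtain u \<gamma> where z: "z = (u, \<gamma>)" "u \<in> U" "\<gamma> \<in> topspace ?E" "endpoints \<gamma> = b"
      by auto
    show "(endpoints (?h z), ?k (endpoints (?h z), ?h z)) = z"
      unfolding z(1) h_end[OF z(2,4)] kh[OF z(2,3)] ..
  next
    fix \<gamma> assume "\<gamma> \<in> topspace ?EU"
    then show "?h (endpoints \<gamma>, ?k (endpoints \<gamma>, \<gamma>)) = \<gamma>"
      by (intro hk) auto
  qed (assumption | rule continuous_map_pairedI)+
  then have "homeomorphic_map (prod_topology (subtopology ?B U) ?F) ?EU ?h"
    using homeomorphic_map_maps by blast
  then show ?thesis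
    using U h_end by (intro exI[of _ U] exI[of _ ?h]) blast
qed

lemma locally_trivial_fibration_constant:
  fixes c :: "nat \<Rightarrow> 'a::euclidean_space"
  assumes dim: "2 \<le> DIM('a)"
  shows "locally_trivial_fibration (E_space n m (\<lambda>t. c)) (B_space n m (\<lambda>t. c)) endpoints"
proof (rule locally_trivial_fibration_connected_base[OF continuous_map_endpoints _ local_triviality_constant])
  show "connected_space (B_space n m (\<lambda>t. c))"
    unfolding B_space_const by (simp add: connected_space_prod_topology connected_space_config[OF dim])
qed

section \<open>From stationary obstacles to arbitrary trajectories\<close>

theorem theorem3p1:
  fixes r n m :: nat
    and Y :: "real \<Rightarrow> nat \<Rightarrow> real ^ 'd"
  assumes "r \<ge> 1" and "n \<ge> 1"
    and "CARD('d) = r + 1"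
    and "obstacle_trajectory m Y"
  shows "locally_trivial_fibration (E_space n m Y) (B_space n m Y) endpoints \<and>
     (\<forall>Y' :: real \<Rightarrow> nat \<Rightarrow> real ^ 'd. obstacle_trajectory m Y' \<longrightarrow>
        (\<exists>F G. homeomorphic_map (E_space n m Y) (E_space n m Y') F \<and>
               homeomorphic_map (B_space n m Y) (B_space n m Y') G \<and>
               (\<forall>\<gamma>\<in>topspace (E_space n m Y). endpoints (F \<gamma>) = G (endpoints \<gamma>)))) \<and>
     (\<forall>c \<in> topspace (config_space (euclidean :: (real ^ 'd) topology) m).
        schwarz_genus (E_space n m Y) (B_space n m Y) endpoints =
        schwarz_genus (E_space n m (\<lambda>t. c)) (B_space n m (\<lambda>t. c)) endpoints) \<and>
     (\<forall>S :: (real ^ 'd) set. finite S \<and> card S = m \<longrightarrow>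
        schwarz_genus (E_space n m Y) (B_space n m Y) endpoints =
        TC (config_space (top_of_set (UNIV - S)) n))"
proof -
  have dim: "2 \<le> DIM(real ^ 'd)"
    using assms(1,3) by simp
  have ends: "endpoints \<in> topspace (E_space n m Z) \<rightarrow> topspace (B_space n m Z)" for Z :: "real \<Rightarrow> nat \<Rightarrow> real ^ 'd"
    using continuous_map_image_subset_topspace[OF continuous_map_endpoints] by blast
  have const: "fibrewise_homeomorphic (E_space n m Z) (B_space n m Z) endpoints
      (E_space n m (\<lambda>t. c)) (B_space n m (\<lambda>t. c)) endpoints"
    if "obstacle_trajectory m Z" "c \<in> topspace (config_space euclidean m)"
    for Z :: "real \<Rightarrow> nat \<Rightarrow> real ^ 'd" and c :: "nat \<Rightarrow> real ^ 'd"
    by (rule fibrewise_homeomorphic_constant[OF dim that])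
  \<comment> \<open>The initial position of \<open>Y\<close> serves as the stationary reference to
    which \<open>Y\<close> and any other trajectory are compared.\<close>
  have Y0: "Y 0 \<in> topspace (config_space euclidean m)"
    using assms(4) continuous_map_image_subset_topspace unfolding obstacle_trajectory_def by fastforce
  have genus_const: "schwarz_genus (E_space n m Y) (B_space n m Y) endpoints =
      schwarz_genus (E_space n m (\<lambda>t. c)) (B_space n m (\<lambda>t. c)) endpoints"
    if "c \<in> topspace (config_space euclidean m)" for c :: "nat \<Rightarrow> real ^ 'd"
    by (rule schwarz_genus_fibrewise_homeomorphic[OF const[OF assms(4) that] ends])
  have "locally_trivial_fibration (E_space n m Y) (B_space n m Y) endpoints"
    by (rule locally_trivial_fibration_fibrewise_homeomorphic[OF locally_trivial_fibration_constant[OF dim]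
          fibrewise_homeomorphic_sym[OF const[OF assms(4) Y0] ends]])
  moreover have "fibrewise_homeomorphic (E_space n m Y) (B_space n m Y) endpoints
      (E_space n m Y') (B_space n m Y') endpoints" if "obstacle_trajectory m Y'" for Y' :: "real \<Rightarrow> nat \<Rightarrow> real ^ 'd"
    by (rule fibrewise_homeomorphic_trans[OF const[OF assms(4) Y0] fibrewise_homeomorphic_sym[OF const[OF that Y0] ends]])
  moreover have "schwarz_genus (E_space n m Y) (B_space n m Y) endpoints = TC (config_space (top_of_set (UNIV - S)) n)"
    if S: "finite S" "card S = m" for S :: "(real ^ 'd) set"
  proof -
    \<comment> \<open>An enumeration of \<open>S\<close> is a configuration of \<open>m\<close>
      stationary obstacles whose complement is that of \<open>S\<close>.\<close>
    obtain f where f: "bij_betw f {1..m} S"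
      using finite_same_card_bij[of "{1..m}" S] S by auto
    define c where "c = restrict f {1..m}"
    have cS: "c ` {1..m} = S" "inj_on c {1..m}"
      using f by (auto simp: c_def bij_betw_def)
    then have "c \<in> topspace (config_space euclidean m)"
      by (auto simp: topspace_config_space c_def)
    from genus_const[OF this] show ?thesis
      unfolding TC_def E_space_const B_space_const cS(1) .
  qed
  ultimately show ?thesis
    using genus_const unfolding fibrewise_homeomorphic_def by (intro conjI allI impI ballI) (assumption | elim conjE | blast)+
qed

end
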